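(* Let $m\ge 1$ be odd, $d\ge 1$, let $R=\sum_{i=0}^{d} a_ix^{2^i}\in\mathbf{F}_{2^m}[x]$ with $a_{d}\neq 0$, and set $f(x)=xR(x)$. Let $\widetilde R=\sum_{i=0}^{d}\left(a_i^{2^{d}}x^{2^{d+i}}+a_i^{2^{d-i}}x^{2^{d-i}}\right)$, let $\mathbf{F}_{2^{mN}}$ be the splitting field of $\widetilde R$ over $\mathbf{F}_{2^m}$, and write $N=2^aN'$ with $N'$ odd. Then: (1) for any $\ell$ such that $v_2(\ell)\neq3$, we have $M_\ell^-(f)=0$; (2) the non zero multiplicities $M^-_{8\ell'}(f)$, $\ell'|N'$, satisfy the system $$2\sqrt2\,\Delta(N')A(N')\Delta(N')\left(M^-_{8\ell'}(f)\right)_{\ell'|N'}=\left(S_n^\ast(f)\right)_{n|N'}.$$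
   Context: Put $S_n(f)=\sum_{x\in\mathbf{F}_{2^{mn}}}(-1)^{\mathrm{Tr}_{\mathbf{F}_{2^{mn}}/\mathbf{F}_2}(f(x))}$, $S_n^\ast(f)=(\sqrt2)^{-mn}S_n(f)$, $L(f,T)=\exp\left(\sum_{n\ge1}S_n(f)\frac{T^n}{n}\right)$, and $L^\ast(f,T)=L(f,T/\sqrt2^{\,m})$. It is known that $L^\ast(f,T)$ is a polynomial of degree $2^{d}$ with coefficients in $\mathbf{Z}[\sqrt2]$ whose reciprocal roots are roots of unity. Let $\zeta_\ell=e^{2i\pi/\ell}$, let $\chi$ be the Dirichlet character modulo $8$ with $\chi(\pm1)=1$, $\chi(\pm3)=-1$, let $\Phi_\ell(T)=\prod_{i\in(\mathbf{Z}/\ell\mathbf{Z})^\times}(1-\zeta_\ell^iT)$, and for $8|\ell$ let $\Phi_\ell^\pm(T)=\prod_{i\in(\mathbf{Z}/\ell\mathbf{Z})^\times,\,\chi(i)=\pm1}(1-\zeta_\ell^iT)$. The irreducible factorization over $\mathbf{Q}(\sqrt2)$ gives $$L^\ast(f,T)=\prod_{v_2(\ell)\le2}\Phi_\ell(T)^{m_\ell(f)}\prod_{v_2(\ell)\ge3}\Phi_\ell^+(T)^{m_\ell^+(f)}\Phi_\ell^-(T)^{m_\ell^-(f)}$$ with nonnegative integer exponents. The negative multiplicities are $M_\ell^-(f)=0$ if $v_2(\ell)\le2$, and $M_\ell^-(f)=\frac{m_\ell^+(f)-m_\ell^-(f)}2$ if $v_2(\ell)\ge3$. For $\ell,n\ge1$,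 $c_\ell(n)=\sum_{i\in(\mathbf{Z}/\ell\mathbf{Z})^\times}\zeta_\ell^{ni}$, and $A(n)=(c_\ell(d'))_{d',\ell|n}$ is the square matrix with rows indexed by divisors $d'$ of $n$ and columns indexed by divisors $\ell$ of $n$. For odd $n'$, $\Delta(n')$ is the diagonal matrix indexed by the divisors of $n'$ whose diagonal coefficients are $\chi(\ell)$, $\ell|n'$. Vectors indexed by divisors are column vectors. $v_2$ is the $2$-adic valuation.
   Formalization: The system in (2) is proved with coefficient −2√2 instead of 2√2: with the given conventions the printed sign fails, e.g. m=d=1, f=x²+x³ has L*=Φ₈⁻, M₈⁻=−1/2, N'=1, S₁*=√2, so the printed equation would read −√2=√2. *)

theory Defs
  imports
    Complex_Main
    "HOL-Computational_Algebra.Computational_Algebra"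
    "HOL-Number_Theory.Totient"
begin

section \<open>Finite fields of characteristic two\<close>

text \<open>
  All fields of characteristic two live inside one algebraically closed field
  of characteristic two, given by a type of class \<^class>\<open>alg_closed_field\<close>. For \<open>r \<ge> 1\<close> such a field
  has exactly one subfield with \<open>2 ^ r\<close> elements, namely the set of roots of \<open>X ^ (2 ^ r) - X\<close>.
\<close>

definition GF2 :: "nat \<Rightarrow> 'k::field set" where
  "GF2 r = {x. x ^ (2 ^ r) = x}"

definition is_subfield :: "'k::field set \<Rightarrow> bool" where
  "is_subfield L \<longleftrightarrow> 0 \<in> L \<and> 1 \<in> L \<and>
     (\<forall>x\<in>L. \<forall>y\<in>L. x + y \<in> L \<and> x * y \<in> L) \<and>
     (\<forall>x\<in>L. - x \<in> L \<and> inverse x \<in> L)"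

text \<open>
  The ambient field is algebraically closed, so the splitting field of \<open>p\<close> over \<open>F\<close> is the
  subfield generated by \<open>F\<close> and by all roots of \<open>p\<close>.
\<close>

definition splitting_field :: "'k::alg_closed_field set \<Rightarrow> 'k poly \<Rightarrow> 'k set" where
  "splitting_field F p = \<Inter> {L. is_subfield L \<and> F \<subseteq> L \<and> {x. poly p x = 0} \<subseteq> L}"

text \<open>
  On \<open>GF2 r\<close> this is the trace to the prime field, as the sum of the Galois conjugates;
  its values there are \<open>0\<close> and \<open>1\<close>.
\<close>

definition abs_trace :: "nat \<Rightarrow> 'k::field \<Rightarrow> 'k" where
  "abs_trace r y = (\<Sum>i<r. y ^ (2 ^ i))"

section \<open>Exponential sums and L-functions\<close>

definition exp_sum :: "nat \<Rightarrow> 'k::field poly \<Rightarrow> nat \<Rightarrow> int" where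
  "exp_sum m f n =
     (\<Sum>x\<in>GF2 (m * n). if abs_trace (m * n) (poly f x) = 0 then 1 else - 1)"

definition exp_sum_star :: "nat \<Rightarrow> 'k::field poly \<Rightarrow> nat \<Rightarrow> real" where
  "exp_sum_star m f n = of_int (exp_sum m f n) / sqrt 2 ^ (m * n)"

definition L_fun :: "nat \<Rightarrow> 'k::field poly \<Rightarrow> complex fps" where
  "L_fun m f = fps_compose (fps_exp 1)
     (Abs_fps (\<lambda>n. if n = 0 then 0 else of_int (exp_sum m f n) / of_nat n))"

definition L_star :: "nat \<Rightarrow> 'k::field poly \<Rightarrow> complex fps" where
  "L_star m f =
     fps_compose (L_fun m f) (fps_const (1 / complex_of_real (sqrt 2 ^ m)) * fps_X)"

section \<open>Cyclotomic factors over the rationals with the square root of two\<close>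

definition zeta :: "nat \<Rightarrow> complex" where
  "zeta l = cis (2 * pi / real l)"

definition chi8 :: "nat \<Rightarrow> int" where
  "chi8 i = (if i mod 8 \<in> {1, 7} then 1 else if i mod 8 \<in> {3, 5} then - 1 else 0)"

text \<open>The polynomials below are normalised to have constant coefficient \<open>1\<close>.\<close>

definition Phi :: "nat \<Rightarrow> complex poly" where
  "Phi l = (\<Prod>i\<in>totatives l. [:1, - (zeta l ^ i):])"

definition Phi_plus :: "nat \<Rightarrow> complex poly" where
  "Phi_plus l = (\<Prod>i | i \<in> totatives l \<and> chi8 i = 1. [:1, - (zeta l ^ i):])"

definition Phi_minus :: "nat \<Rightarrow> complex poly" where
  "Phi_minus l = (\<Prod>i | i \<in> totatives l \<and> chi8 i = - 1. [:1, - (zeta l ^ i):])"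

text \<open>
  \<open>L_exponents m f mu mu_p mu_m\<close> says that \<open>mu\<close>, \<open>mu_p\<close>, \<open>mu_m\<close> are the exponents of
  \<open>Phi\<close>, \<open>Phi_plus\<close>, \<open>Phi_minus\<close> in the irreducible factorization of \<open>L_star m f\<close> over
  \<open>\<rat>(\<surd>2)\<close>. It determines \<open>mu l\<close> for \<open>l > 0\<close> of 2-adic valuation at most 2, and
  \<open>mu_p l\<close>, \<open>mu_m l\<close> for \<open>l > 0\<close> of 2-adic valuation at least 3; the other values are irrelevant.
\<close>

definition L_exponents ::
  "nat \<Rightarrow> 'k::field poly \<Rightarrow> (nat \<Rightarrow> nat) \<Rightarrow> (nat \<Rightarrow> nat) \<Rightarrow> (nat \<Rightarrow> nat) \<Rightarrow> bool" where
  "L_exponents m f mu mu_p mu_m \<longleftrightarrow>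
     (let A = {l. l > 0 \<and> multiplicity 2 l \<le> 2 \<and> mu l \<noteq> 0};
          B = {l. l > 0 \<and> multiplicity 2 l \<ge> 3 \<and> (mu_p l \<noteq> 0 \<or> mu_m l \<noteq> 0)}
      in finite A \<and> finite B \<and>
         L_star m f = fps_of_poly
           ((\<Prod>l\<in>A. Phi l ^ mu l) *
            (\<Prod>l\<in>B. Phi_plus l ^ mu_p l * Phi_minus l ^ mu_m l)))"

definition neg_mult :: "(nat \<Rightarrow> nat) \<Rightarrow> (nat \<Rightarrow> nat) \<Rightarrow> nat \<Rightarrow> real" where
  "neg_mult mu_p mu_m l =
     (if multiplicity 2 l \<le> 2 then 0 else (real (mu_p l) - real (mu_m l)) / 2)"

section \<open>The linear system\<close>

text \<open>
  Matrices and column vectors indexed by the divisors of \<open>n\<close> are functions on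
  \<^typ>\<open>nat\<close>; only their values at divisors of \<open>n\<close> enter the products.
\<close>

definition divisors :: "nat \<Rightarrow> nat set" where
  "divisors n = {k. k dvd n}"

definition mat_mul :: "nat \<Rightarrow> (nat \<Rightarrow> nat \<Rightarrow> complex) \<Rightarrow> (nat \<Rightarrow> nat \<Rightarrow> complex) \<Rightarrow> nat \<Rightarrow> nat \<Rightarrow> complex"
  where "mat_mul n X Y i j = (\<Sum>k\<in>divisors n. X i k * Y k j)"

definition mat_vec :: "nat \<Rightarrow> (nat \<Rightarrow> nat \<Rightarrow> complex) \<Rightarrow> (nat \<Rightarrow> complex) \<Rightarrow> nat \<Rightarrow> complex"
  where "mat_vec n X v i = (\<Sum>j\<in>divisors n. X i j * v j)"

definition ramanujan_c :: "nat \<Rightarrow> nat \<Rightarrow> complex" where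
  "ramanujan_c l n = (\<Sum>i\<in>totatives l. zeta l ^ (n * i))"

definition A_mat :: "nat \<Rightarrow> nat \<Rightarrow> complex" where
  "A_mat k l = ramanujan_c l k"

definition Delta_mat :: "nat \<Rightarrow> nat \<Rightarrow> complex" where
  "Delta_mat k l = (if k = l then of_int (chi8 l) else 0)"

section \<open>The additive polynomials\<close>

definition R_poly :: "nat \<Rightarrow> (nat \<Rightarrow> 'k::field) \<Rightarrow> 'k poly" where
  "R_poly d a = (\<Sum>i\<le>d. monom (a i) (2 ^ i))"

definition f_poly :: "nat \<Rightarrow> (nat \<Rightarrow> 'k::field) \<Rightarrow> 'k poly" where
  "f_poly d a = [:0, 1:] * R_poly d a"

definition R_tilde :: "nat \<Rightarrow> (nat \<Rightarrow> 'k::field) \<Rightarrow> 'k poly" where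
  "R_tilde d a = (\<Sum>i\<le>d. monom (a i ^ (2 ^ d)) (2 ^ (d + i)) +
                         monom (a i ^ (2 ^ (d - i))) (2 ^ (d - i)))"

text \<open>
  Sign of the system. If \<open>L_star m f\<close> is the product of the factors \<open>1 - \<alpha> T\<close>, then
  \<open>L_star m f = exp (\<Sum>n\<ge>1. exp_sum_star m f n * T ^ n / n)\<close> gives
  \<open>exp_sum_star m f n = - (\<Sum>\<alpha>. \<alpha> ^ n)\<close>. With these conventions the coefficient of
  \<open>\<Delta> A \<Delta>\<close> in the linear system is therefore \<open>- 2 * sqrt 2\<close>.
  For instance, for \<open>m = d = 1\<close> and \<open>f = x ^ 3 + x ^ 2\<close> one finds
  \<open>L_star m f = 1 + sqrt 2 * T + T ^ 2 = Phi_minus 8\<close>, so the negative multiplicity at 8 is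
  \<open>- 1 / 2\<close>, while \<open>exp_sum_star m f 1 = sqrt 2\<close>.
\<close>

end

theory Submission
  imports "HOL-Number_Theory.Gauss" Defs
begin

text \<open>
  Write \<open>S n\<close> for \<open>exp_sum_star m (f_poly d a) n\<close>, \<open>\<chi>\<close> for \<open>chi8\<close>, and \<open>M l\<close> for the negative
  multiplicities. Comparing logarithmic derivatives, \<open>- S n\<close> is the sum of the \<open>n\<close>-th powers of the
  reciprocal roots of \<open>L_star\<close>. Conjugation \<open>\<surd>2 \<mapsto> - \<surd>2\<close> exchanges \<open>Phi_plus l\<close> and \<open>Phi_minus l\<close>
  and multiplies \<open>S n\<close> by \<open>(- 1) ^ n\<close>, because \<open>S n\<close> is an integer divided by \<open>(\<surd>2) ^ (m * n)\<close> with
  \<open>m\<close> odd. The part of the power sum that changes sign under conjugation is therefore all of it for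
  odd \<open>n\<close>, and zero for even \<open>n\<close>: with the twisted Ramanujan sum
  \<open>G l n = (\<Sum>i. \<chi> i * zeta l ^ (n * i))\<close> over the units \<open>i\<close> modulo \<open>l\<close>,
  \<open>(\<Sum>l. M l * G l n)\<close> is \<open>- S n\<close> for odd \<open>n\<close> and \<open>0\<close> for even \<open>n\<close> (\<open>exp_sum_star_twisted\<close>).

  The equations for even \<open>n\<close> say that opposite roots of unity carry opposite weights in
  this sum. If \<open>16\<close> divides \<open>l\<close>, then \<open>- zeta l\<close> is a primitive \<open>l\<close>-th root of unity with the same value
  of \<open>\<chi>\<close> as \<open>zeta l\<close>, so \<open>M l = 0\<close> (\<open>twisted_sums_even_vanish\<close>). Only \<open>l = 8 * l'\<close> with \<open>l'\<close> odd is
  left, where \<open>G (8 * l') n = 2 * \<surd>2 * \<chi> l' * \<chi> n * c l' n\<close> for odd \<open>n\<close>, with \<open>c\<close> the Ramanujan sum, by the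
  Chinese remainder theorem (\<open>twisted_c_8_mult\<close>). This turns the equations for odd \<open>n\<close> into the linear
  system, except that the sum over \<open>l'\<close> still has to be restricted to the divisors of \<open>N'\<close>.

  For the restriction it suffices that \<open>\<chi> n * S n\<close> depends, for odd \<open>n\<close>, only on \<open>gcd n N'\<close>
  (\<open>twisted_exp_sum_star_gcd\<close>): then \<open>(\<Sum>l'. \<chi> l' * M (8 * l') * c l' n)\<close> is \<open>N'\<close>-periodic in
  \<open>n\<close>, and by linear independence of the characters \<open>n \<mapsto> z ^ n\<close> only the \<open>l'\<close> dividing \<open>N'\<close> occur. Raising \<open>n\<close> one
  prime at a time, this says \<open>S (n * p) = \<chi> p * S n\<close> when \<open>p\<close> is an odd prime such that
  \<open>R_tilde\<close> has no further roots in the larger field. Let \<open>V\<close> be the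
  kernel of the trace from the larger field to the smaller one. The quadratic form
  \<open>x \<mapsto> Tr (x * R x)\<close> splits orthogonally along the smaller field and \<open>V\<close>. It is nondegenerate on
  \<open>V\<close>, as its radical consists of roots of \<open>R_tilde\<close>, which lie in the smaller field. Hence the sum over \<open>V\<close> is
  \<open>\<plusminus> 2 ^ (r * (p - 1) / 2)\<close> with \<open>r = m * n\<close> odd. The Frobenius map of the extension acts on \<open>V - {0}\<close> with all orbits of
  length \<open>p\<close> and preserves the form, so the sum is \<open>1\<close> modulo \<open>p\<close>; and
  \<open>2 ^ ((p - 1) / 2)\<close> is \<open>\<chi> p\<close> modulo \<open>p\<close>. This determines the sign as \<open>\<chi> p\<close>.
\<close>

section \<open>The quadratic character modulo 8\<close>

lemma chi8_values: "odd n \<Longrightarrow> chi8 n = 1 \<or> chi8 n = - 1"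
proof -
  assume "odd n"
  then have "n mod 8 \<in> {1, 3, 5, 7}" by simp presburger
  then show ?thesis by (auto simp: chi8_def)
qed

lemma chi8_even: "even n \<Longrightarrow> chi8 n = 0"
proof -
  assume "even n"
  then have "n mod 8 \<notin> {1, 3, 5, 7}" by simp presburger
  then show ?thesis by (auto simp: chi8_def)
qed

lemma chi8_mod: "chi8 (i mod 8) = chi8 i"
  by (simp add: chi8_def)

lemma chi8_mult: "chi8 (i * j) = chi8 i * chi8 j"
proof (cases "odd i \<and> odd j")
  case True
  define u v where "u = i mod 8" and "v = j mod 8"
  have "chi8 (i * j) = chi8 (u * v)"
    unfolding u_def v_def chi8_def by (simp add: mod_mult_eq)
  moreover have uv: "u = 1 \<or> u = 3 \<or> u = 5 \<or> u = 7" "v = 1 \<or> v = 3 \<or> v = 5 \<or> v = 7"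
    using True unfolding u_def v_def by presburger+
  have "chi8 (u * v) = chi8 u * chi8 v"
    using uv by (elim disjE) (simp_all add: chi8_def)
  ultimately show ?thesis by (simp add: u_def v_def chi8_mod)
next
  case False
  then show ?thesis by (auto simp: chi8_even)
qed

text \<open>By Gauss's lemma the power is \<open>(- 1) ^ k\<close>, where \<open>k\<close> counts the \<open>x \<le> (p - 1) / 2\<close> whose double exceeds
  \<open>(p - 1) / 2\<close>; the parity of \<open>k\<close> depends only on \<open>p\<close> modulo 8.\<close>

lemma two_power_half_cong_chi8:
  assumes p: "prime p" "odd p"
  shows "[2 ^ ((p - 1) div 2) = chi8 p] (mod int p)"
proof -
  have p3: "p > 2" using p prime_ge_2_nat[of p] by (cases "p = 2") auto
  interpret GAUSS p 2
    using p p3 by unfold_locales (auto simp: cong_iff_dvd_diff dest: zdvd_imp_le)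
  define h where "h = (p - 1) div 2"
  have h: "p = 2 * h + 1" using p by (auto simp: h_def elim!: oddE)
  have half: "(int p - 1) div 2 = int h" and int_p: "int p = 2 * int h + 1"
    using h by simp_all
  have double_mod: "x * 2 mod int p = 2 * x" if "0 < x" "x \<le> int h" for x
    unfolding int_p using that by simp
  have "E = (\<lambda>x. 2 * x) ` {int (h div 2) + 1 .. int h}"
  proof (intro equalityI subsetI)
    fix y assume "y \<in> E"
    then obtain x where x: "0 < x" "x \<le> int h" "y = x * 2 mod int p" "int h < y"
      unfolding E_def C_def B_def A_def half by auto
    then have "y = 2 * x" using double_mod by simp
    moreover have "int (h div 2) + 1 \<le> x" using x(4) unfolding \<open>y = 2 * x\<close> by linarith
    ultimately show "y \<in> (\<lambda>x. 2 * x) ` {int (h div 2) + 1 .. int h}"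
      using x(2) by simp
  next
    fix y assume "y \<in> (\<lambda>x. 2 * x) ` {int (h div 2) + 1 .. int h}"
    then obtain x where x: "y = 2 * x" "int (h div 2) + 1 \<le> x" "x \<le> int h" by auto
    then have pos: "int h < 2 * x" "0 < x" by linarith+
    have "y = x * 2 mod int p" using double_mod x pos by simp
    then have "y \<in> C" unfolding C_def B_def A_def half using x pos by auto
    then show "y \<in> E" unfolding E_def half using x pos by simp
  qed
  then have "card E = h - h div 2"
    by (simp add: card_image inj_on_def)
  moreover have "(- 1) ^ (h - h div 2) = chi8 p"
  proof -
    define k where "k = h div 4"
    have "h = 4 * k \<or> h = 4 * k + 1 \<or> h = 4 * k + 2 \<or> h = 4 * k + 3"
      unfolding k_def by presburger
    moreover have "4 * k + 3 - (4 * k + 3) div 2 = 2 * (k + 1)" by presburger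
    ultimately show ?thesis
      by (elim disjE) (auto simp: h chi8_def)
  qed
  ultimately show ?thesis
    using pre_gauss_lemma unfolding half h_def[symmetric] by simp
qed

section \<open>Subfields of a field of characteristic two\<close>

lemma frobenius_add:
  fixes x y :: "'k::field"
  assumes "CHAR('k) = 2"
  shows "(x + y) ^ (2 ^ n) = x ^ (2 ^ n) + y ^ (2 ^ n)"
  using freshmans_dream'[of "2 ^ n" n x y] assms by simp

lemma frobenius_sum:
  fixes g :: "'b \<Rightarrow> 'k::field"
  assumes "CHAR('k) = 2"
  shows "sum g A ^ (2 ^ n) = (\<Sum>i\<in>A. g i ^ (2 ^ n))"
  using freshmans_dream_sum'[of "2 ^ n" n g A] assms by simp

lemma char2_add_self:
  fixes x :: "'k::field"
  assumes "CHAR('k) = 2"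
  shows "x + x = 0"
proof -
  have "of_nat 2 = (0 :: 'k)"
    unfolding of_nat_eq_0_iff_char_dvd using assms by simp
  then have "(2 :: 'k) = 0" by simp
  then show ?thesis by (metis mult_2 mult_zero_left)
qed

lemma char2_of_odd:
  assumes "CHAR('k::field) = 2" "odd n"
  shows "(of_nat n :: 'k) = 1"
proof -
  obtain k where "n = 2 * k + 1" using assms(2) oddE by blast
  moreover have "of_nat (2 * k) = (0 :: 'k)"
    using assms(1) by (simp only: of_nat_eq_0_iff_char_dvd) simp
  ultimately show ?thesis by simp
qed

lemma frobenius_iterate: "((x::'k::field) ^ (2 ^ i)) ^ (2 ^ j) = x ^ (2 ^ (i + j))"
  by (simp add: power_add power_mult)

lemma zero_in_GF2 [simp]: "0 \<in> GF2 r"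
  by (simp add: GF2_def)

lemma GF2_add:
  assumes "CHAR('k::field) = 2" "(x::'k) \<in> GF2 r" "y \<in> GF2 r"
  shows "x + y \<in> GF2 r"
  using assms by (simp add: GF2_def frobenius_add)

lemma GF2_sum:
  assumes "CHAR('k::field) = 2" "\<And>i. i \<in> A \<Longrightarrow> (g i::'k) \<in> GF2 r"
  shows "sum g A \<in> GF2 r"
  using assms(2) by (induction A rule: infinite_finite_induct) (auto intro: GF2_add[OF assms(1)])

lemma GF2_mult: "x \<in> GF2 r \<Longrightarrow> y \<in> GF2 r \<Longrightarrow> x * y \<in> GF2 r"
  by (simp add: GF2_def power_mult_distrib)

lemma GF2_divide: "x \<in> GF2 r \<Longrightarrow> y \<in> GF2 r \<Longrightarrow> x / y \<in> GF2 r"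
  by (simp add: GF2_def power_divide)

lemma GF2_power: "x \<in> GF2 r \<Longrightarrow> x ^ n \<in> GF2 r"
  by (simp add: GF2_def flip: power_mult) (metis mult.commute power_mult)

lemma GF2_frobenius_multiple:
  assumes "x \<in> GF2 r"
  shows "x ^ (2 ^ (r * n)) = x"
proof (induction n)
  case (Suc n)
  have "x ^ (2 ^ (r * Suc n)) = (x ^ (2 ^ (r * n))) ^ (2 ^ r)"
    by (simp add: frobenius_iterate add.commute)
  then show ?case using Suc assms by (simp add: GF2_def)
qed simp

lemma GF2_dvd: "r dvd s \<Longrightarrow> GF2 r \<subseteq> GF2 s"
  by (auto simp: GF2_def elim!: dvdE intro: GF2_frobenius_multiple[unfolded GF2_def, simplified])

text \<open>The exponents \<open>n\<close> for which the \<open>n\<close>-th Frobenius iterate fixes \<open>x\<close> are closed under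
  remainders, so the Euclidean algorithm reaches the greatest common divisor.\<close>

lemma GF2_gcd:
  assumes "x \<in> GF2 r" "x \<in> GF2 s"
  shows "x \<in> GF2 (gcd r s)"
  using assms
proof (induction r s rule: gcd_nat_induct)
  case (step r s)
  have "x = x ^ (2 ^ (s * (r div s) + r mod s))"
    using step.prems by (simp add: GF2_def)
  also have "\<dots> = (x ^ (2 ^ (s * (r div s)))) ^ (2 ^ (r mod s))"
    by (simp only: frobenius_iterate)
  also have "\<dots> = x ^ (2 ^ (r mod s))"
    using GF2_frobenius_multiple[OF step.prems(2)] by simp
  finally have "x \<in> GF2 (r mod s)" by (simp add: GF2_def)
  then show ?case using step by (simp add: gcd_red_nat[of r s])
qed simp

text \<open>The derivative of \<open>X ^ (2 ^ r) - X\<close> is the constant \<open>- 1\<close>, so all its roots are simple.\<close>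

lemma card_GF2:
  assumes char2: "CHAR('k::alg_closed_field) = 2" and r: "r \<ge> 1"
  shows "finite (GF2 r :: 'k set)" "card (GF2 r :: 'k set) = 2 ^ r"
proof -
  define P :: "'k poly" where "P = monom 1 (2 ^ r) - [:0, 1:]"
  have r2: "(2::nat) ^ r > 1"
    using r by (intro one_less_power) auto
  have deg: "degree P = 2 ^ r" and lead: "lead_coeff P = 1"
  proof -
    have "coeff P (2 ^ r) = 1" using r r2 by (simp add: P_def coeff_pCons split: nat.split)
    moreover have "degree P \<le> 2 ^ r"
      unfolding P_def using r2 by (intro degree_diff_le) (auto simp: degree_monom_le)
    ultimately show "degree P = 2 ^ r" by (metis le_antisym le_degree zero_neq_one)
    with \<open>coeff P (2 ^ r) = 1\<close> show "lead_coeff P = 1" by simp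
  qed
  then have "P \<noteq> 0" by auto
  then obtain A where A: "size A = degree P" "P = (\<Prod>x\<in>#A. [:- x, 1:])"
    using alg_closed_imp_factorization[of P] lead by auto
  have roots: "GF2 r = {x. poly P x = 0}"
    by (auto simp: GF2_def P_def poly_monom)
  have roots': "GF2 r = set_mset A"
  proof -
    have "poly P x = 0 \<longleftrightarrow> x \<in># A" for x
      unfolding A(2) by (auto simp: poly_prod_mset prod_mset_zero_iff)
    then show ?thesis by (simp add: roots)
  qed
  have "of_nat (2 ^ r) = (0 :: 'k)"
    using char2 r by (simp only: of_nat_eq_0_iff_char_dvd) simp
  then have deriv: "pderiv P = [:- 1:]"
    using r by (simp add: P_def pderiv_diff pderiv_monom pderiv_pCons power_0_left)
  have simple: "count A x = 1" if "x \<in># A" for x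
  proof (rule ccontr)
    assume "count A x \<noteq> 1"
    moreover have "count A x > 0" using that by simp
    ultimately obtain k where "count A x = Suc (Suc k)"
      by (metis One_nat_def not0_implies_Suc not_gr_zero)
    then obtain B where B: "A = add_mset x (add_mset x B)"
      by (metis count_add_mset diff_Suc_1 insert_DiffM not_in_iff old.nat.distinct(1) that)
    define Q where "Q = (\<Prod>y\<in>#B. [:- y, 1:])"
    have "P = [:- x, 1:] * ([:- x, 1:] * Q)"
      unfolding A(2) B Q_def by (simp only: image_mset_add_mset prod_mset.add_mset)
    then have "poly (pderiv P) x = 0"
      by (simp add: pderiv_mult del: mult_pCons_left)
    then show False by (simp add: deriv)
  qed
  show "finite (GF2 r :: 'k set)" using roots' by simp
  have "size A = (\<Sum>x\<in>set_mset A. count A x)"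
    by (simp add: size_multiset_overloaded_eq)
  then show "card (GF2 r :: 'k set) = 2 ^ r"
    using simple A(1) deg roots' by simp
qed

section \<open>Traces\<close>

lemma abs_trace_add:
  assumes "CHAR('k::field) = 2"
  shows "abs_trace r (x + y :: 'k) = abs_trace r x + abs_trace r y"
  by (simp add: abs_trace_def frobenius_add[OF assms] sum.distrib)

lemma abs_trace_0 [simp]: "abs_trace r 0 = 0"
  by (simp add: abs_trace_def power_0_left)

lemma abs_trace_sum:
  assumes "CHAR('k::field) = 2"
  shows "abs_trace r (sum g A :: 'k) = (\<Sum>i\<in>A. abs_trace r (g i))"
  by (induction A rule: infinite_finite_induct) (simp_all add: abs_trace_add[OF assms])

text \<open>Squaring shifts the conjugates by one step, and the last one wraps around to the first.\<close>

lemma abs_trace_square: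
  assumes "(y::'k::field) \<in> GF2 r"
  shows "abs_trace r (y ^ 2) = abs_trace r y"
proof -
  have "abs_trace r (y ^ 2) + y = (\<Sum>i<r. y ^ (2 ^ Suc i)) + y ^ (2 ^ 0)"
    by (simp add: abs_trace_def flip: power_mult)
  also have "\<dots> = (\<Sum>i<Suc r. y ^ (2 ^ i))"
    by (subst sum.lessThan_Suc_shift) simp
  also have "\<dots> = abs_trace r y + y"
    using assms by (simp add: abs_trace_def GF2_def)
  finally show ?thesis by simp
qed

lemma abs_trace_frobenius:
  assumes "(y::'k::field) \<in> GF2 r"
  shows "abs_trace r (y ^ (2 ^ j)) = abs_trace r y"
proof (induction j)
  case (Suc j)
  have "y ^ (2 ^ Suc j) = (y ^ (2 ^ j)) ^ 2"
    by (simp add: power_mult mult.commute flip: power_mult)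
  then show ?case
    using Suc abs_trace_square[OF GF2_power[OF assms]] by metis
qed simp

lemma abs_trace_values:
  assumes "CHAR('k::field) = 2" "(y::'k) \<in> GF2 r"
  shows "abs_trace r y = 0 \<or> abs_trace r y = 1"
proof -
  have "abs_trace r y ^ (2 ^ 1) = abs_trace r (y ^ 2)"
    unfolding abs_trace_def frobenius_sum[OF assms(1)]
    by (simp add: mult.commute flip: power_mult)
  then have "abs_trace r y ^ 2 = abs_trace r y"
    using abs_trace_square[OF assms(2)] by simp
  then show ?thesis by (simp add: power2_eq_square)
qed

text \<open>Nondegeneracy of the trace form: a nonzero \<open>w\<close> would make the trace, a polynomial of degree
  \<open>2 ^ (r - 1)\<close>, vanish on all \<open>2 ^ r\<close> elements of the field.\<close>

lemma abs_trace_nondegenerate: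
  assumes char2: "CHAR('k::alg_closed_field) = 2" and r: "r \<ge> 1"
    and w: "(w::'k) \<in> GF2 r" "\<And>y. y \<in> GF2 r \<Longrightarrow> abs_trace r (y * w) = 0"
  shows "w = 0"
proof (rule ccontr)
  assume "w \<noteq> 0"
  define P :: "'k poly" where "P = (\<Sum>i<r. monom 1 (2 ^ i))"
  have "coeff P (2 ^ (r - 1)) = (\<Sum>i<r. if i = r - 1 then 1 else 0)"
    by (simp add: P_def coeff_sum)
  also have "\<dots> = 1" using r by simp
  finally have "P \<noteq> 0" by auto
  have "degree P \<le> 2 ^ (r - 1)"
    unfolding P_def
    by (intro degree_sum_le) (auto intro!: order.trans[OF degree_monom_le])
  have "GF2 r \<subseteq> {x. poly P x = 0}"
  proof
    fix t :: 'k assume t: "t \<in> GF2 r"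
    have "abs_trace r (t / w * w) = 0"
      using w GF2_divide[OF t w(1)] by blast
    then show "t \<in> {x. poly P x = 0}"
      using \<open>w \<noteq> 0\<close> by (simp add: P_def poly_sum poly_monom abs_trace_def)
  qed
  then have "card (GF2 r :: 'k set) \<le> card {x. poly P x = 0}"
    using \<open>P \<noteq> 0\<close> by (intro card_mono poly_roots_finite)
  also have "\<dots> \<le> 2 ^ (r - 1)"
    using card_poly_roots_bound[OF \<open>P \<noteq> 0\<close>] \<open>degree P \<le> _\<close> by simp
  finally have "(2::nat) ^ r \<le> 2 ^ (r - 1)"
    unfolding card_GF2(2)[OF char2 r] .
  then have "r \<le> r - 1"
    by (rule power_le_imp_le_exp[rotated]) simp
  then show False using r by simp
qed

definition rel_trace :: "nat \<Rightarrow> nat \<Rightarrow> 'k::field \<Rightarrow> 'k" where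
  "rel_trace r p y = (\<Sum>i<p. y ^ (2 ^ (r * i)))"

lemma sum_lessThan_add:
  fixes g :: "nat \<Rightarrow> 'b::comm_monoid_add"
  shows "(\<Sum>i<m + n. g i) = (\<Sum>i<m. g i) + (\<Sum>i<n. g (m + i))"
  by (induction n) (simp_all add: add.assoc)

lemma abs_trace_tower:
  assumes "CHAR('k::field) = 2"
  shows "abs_trace (r * p) (y::'k) = abs_trace r (rel_trace r p y)"
proof (induction p)
  case (Suc p)
  have "abs_trace (r * Suc p) y = (\<Sum>i<r * p + r. y ^ (2 ^ i))"
    by (simp add: abs_trace_def add.commute)
  also have "\<dots> = abs_trace (r * p) y + (\<Sum>i<r. y ^ (2 ^ (r * p + i)))"
    unfolding abs_trace_def by (rule sum_lessThan_add)
  also have "(\<Sum>i<r. y ^ (2 ^ (r * p + i))) = abs_trace r (y ^ (2 ^ (r * p)))"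
    by (simp add: abs_trace_def frobenius_iterate)
  finally show ?case
    using Suc by (simp add: rel_trace_def abs_trace_add[OF assms])
qed (simp add: rel_trace_def, simp add: abs_trace_def)


section \<open>Sums of signs of quadratic forms\<close>

definition add_char :: "'k::zero \<Rightarrow> int" where
  "add_char t = (if t = 0 then 1 else - 1)"

lemma add_char_0 [simp]: "add_char 0 = 1"
  by (simp add: add_char_def)

lemma add_char_square [simp]: "add_char t * add_char t = 1"
  by (simp add: add_char_def)

lemma add_char_add:
  fixes s t :: "'k::field"
  assumes "CHAR('k) = 2" "s = 0 \<or> s = 1" "t = 0 \<or> t = 1"
  shows "add_char (s + t) = add_char s * add_char t"
  using assms char2_add_self[OF assms(1), of 1] by (auto simp: add_char_def)

text \<open>Here \<open>e\<close> is the sign of a quadratic form on \<open>V\<close> and \<open>b\<close> that of its polar form. Substituting \<open>y = x + z\<close>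
  in the double sum over \<open>x\<close> and \<open>y\<close> turns \<open>e x * e y\<close> into \<open>e z * b x z\<close>. The sum of the latter over \<open>x\<close> is
  a character sum, which vanishes unless \<open>z = 0\<close>.\<close>

lemma nondegenerate_quadratic_sum_square:
  fixes e :: "'a::ab_group_add \<Rightarrow> int" and b :: "'a \<Rightarrow> 'a \<Rightarrow> int"
  assumes fin: "finite V" and V0: "0 \<in> V"
    and add: "\<And>x y. x \<in> V \<Longrightarrow> y \<in> V \<Longrightarrow> x + y \<in> V"
    and e0: "e 0 = 1" and e_sq: "\<And>x. x \<in> V \<Longrightarrow> e x * e x = 1"
    and polar: "\<And>x z. x \<in> V \<Longrightarrow> z \<in> V \<Longrightarrow> e (x + z) = e x * e z * b x z"
    and b_add: "\<And>x y z. x \<in> V \<Longrightarrow> y \<in> V \<Longrightarrow> z \<in> V \<Longrightarrow> b (x + y) z = b x z * b y z"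
    and nondeg: "\<And>z. z \<in> V \<Longrightarrow> z \<noteq> 0 \<Longrightarrow> \<exists>x\<in>V. b x z = - 1"
  shows "(\<Sum>x\<in>V. e x)\<^sup>2 = int (card V)"
proof -
  have trans: "bij_betw (\<lambda>y. x + y) V V" if "x \<in> V" for x
  proof -
    have inj: "inj_on (\<lambda>y. x + y) V" by (simp add: inj_on_def)
    moreover have "(\<lambda>y. x + y) ` V \<subseteq> V" using add that by auto
    ultimately show ?thesis
      using endo_inj_surj[OF fin] by (simp add: bij_betw_def)
  qed
  have char_sum: "(\<Sum>x\<in>V. b x z) = (if z = 0 then int (card V) else 0)" if z: "z \<in> V" for z
  proof (cases "z = 0")
    case True
    have "b x 0 = 1" if "x \<in> V" for x
    proof -
      have "e x * b x 0 = e x" using polar[OF that V0] e0 by simp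
      moreover have "e x \<noteq> 0" using e_sq[OF that] by force
      ultimately show ?thesis by simp
    qed
    then show ?thesis using True by simp
  next
    case False
    then obtain x0 where x0: "x0 \<in> V" "b x0 z = - 1" using nondeg z by blast
    have "(\<Sum>x\<in>V. b x z) = (\<Sum>x\<in>V. b (x0 + x) z)"
      by (rule sum.reindex_bij_betw[OF trans[OF x0(1)], symmetric])
    also have "\<dots> = - (\<Sum>x\<in>V. b x z)"
      using x0 z by (simp add: b_add sum_negf)
    finally show ?thesis using False by simp
  qed
  have "(\<Sum>x\<in>V. e x)\<^sup>2 = (\<Sum>x\<in>V. \<Sum>y\<in>V. e x * e y)"
    by (simp add: power2_eq_square sum_product)
  also have "\<dots> = (\<Sum>x\<in>V. \<Sum>z\<in>V. e z * b x z)"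
  proof (rule sum.cong[OF refl])
    fix x assume x: "x \<in> V"
    have "(\<Sum>y\<in>V. e x * e y) = (\<Sum>z\<in>V. e x * e (x + z))"
      by (rule sum.reindex_bij_betw[OF trans[OF x], symmetric])
    also have "\<dots> = (\<Sum>z\<in>V. (e x * e x) * (e z * b x z))"
      by (intro sum.cong refl) (simp add: polar x mult_ac)
    finally show "(\<Sum>y\<in>V. e x * e y) = (\<Sum>z\<in>V. e z * b x z)"
      by (simp add: e_sq x)
  qed
  also have "\<dots> = (\<Sum>z\<in>V. e z * (\<Sum>x\<in>V. b x z))"
    by (subst sum.swap) (simp add: sum_distrib_left)
  also have "\<dots> = (\<Sum>z\<in>V. if z = 0 then int (card V) else 0)"
    by (intro sum.cong refl) (simp add: char_sum e0)
  finally show ?thesis using fin V0 by simp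
qed

text \<open>\<open>F\<close> generates an action of the cyclic group of prime order \<open>p\<close>. Stabilisers are trivial or everything,
  and a point fixed by a nontrivial element would be fixed by \<open>F\<close>; so all orbits have \<open>p\<close> elements.\<close>

lemma prime_dvd_card_free_action:
  assumes fin: "finite A" and p: "prime p"
    and F: "\<And>x. x \<in> A \<Longrightarrow> F x \<in> A" and period: "\<And>x. x \<in> A \<Longrightarrow> (F ^^ p) x = x"
    and free: "\<And>x. x \<in> A \<Longrightarrow> F x \<noteq> x"
  shows "p dvd card A"
proof -
  define orb where "orb x = range (\<lambda>i. (F ^^ i) x)" for x
  have in_A: "(F ^^ i) x \<in> A" if "x \<in> A" for i x
    by (induction i) (simp_all add: F that)
  have period_mult: "(F ^^ (k * j)) x = x" if "x \<in> A" "(F ^^ k) x = x" for k j x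
    by (induction j) (simp_all add: that funpow_add)
  have mod_p: "(F ^^ i) x = (F ^^ (i mod p)) x" if "x \<in> A" for i x
  proof -
    have "(F ^^ i) x = (F ^^ (i mod p + p * (i div p))) x" by simp
    also have "\<dots> = (F ^^ (i mod p)) x"
      unfolding funpow_add using period_mult[OF that period[OF that]] by simp
    finally show ?thesis .
  qed
  have card_orb: "card (orb x) = p" if x: "x \<in> A" for x
  proof -
    have "orb x = (\<lambda>i. (F ^^ i) x) ` {..<p}"
      unfolding orb_def using mod_p[OF x] prime_gt_0_nat[OF p] by fastforce
    moreover have "inj_on (\<lambda>i. (F ^^ i) x) {..<p}"
    proof (rule linorder_inj_onI)
      fix i j assume ij: "i < j" "j \<in> {..<p}"
      show "(F ^^ i) x \<noteq> (F ^^ j) x"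
      proof
        assume eq: "(F ^^ i) x = (F ^^ j) x"
        define y where "y = (F ^^ i) x"
        have "(F ^^ (j - i)) y = (F ^^ (j - i + i)) x"
          unfolding y_def funpow_add by simp
        also have "\<dots> = y" using ij eq by (simp add: y_def)
        finally have y: "y \<in> A" "(F ^^ (j - i)) y = y"
          using in_A[OF x] by (simp_all add: y_def)
        have "coprime p (j - i)"
          using ij p by (intro prime_imp_coprime nat_dvd_not_less) auto
        \<comment> \<open>A power of the iterate fixing \<open>y\<close> is \<open>F\<close> itself, up to the period \<open>p\<close>.\<close>
        then have "gcd (j - i) p = 1" by (simp add: gcd.commute)
        moreover have "j - i \<noteq> 0" using ij by simp
        ultimately obtain u v where uv: "(j - i) * u = p * v + 1"
          using bezout_nat[of "j - i" p] by metis
        have "y = (F ^^ ((j - i) * u)) y" by (rule period_mult[OF y, symmetric])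
        also have "\<dots> = F ((F ^^ (p * v)) y)" unfolding uv by simp
        also have "\<dots> = F y" using period_mult[OF y(1) period[OF y(1)]] by simp
        finally show False using free[OF y(1)] by simp
      qed
    qed auto
    ultimately show ?thesis by (simp add: card_image)
  qed
  have orb_sub: "orb y \<subseteq> orb x" if A: "x \<in> A" "y \<in> A" and z: "z \<in> orb x" "z \<in> orb y" for x y z
  proof -
    obtain i where i: "z = (F ^^ i) x" using z(1) unfolding orb_def by (rule rangeE)
    obtain j where j: "z = (F ^^ j) y" using z(2) unfolding orb_def by (rule rangeE)
    have z': "z = (F ^^ (j mod p)) y" unfolding j by (rule mod_p[OF A(2)])
    have "y = (F ^^ (p - j mod p + j mod p)) y"
      using period[OF A(2)] prime_gt_0_nat[OF p] by simp
    also have "\<dots> = (F ^^ (p - j mod p)) z"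
      unfolding funpow_add using z' by simp
    also have "\<dots> = (F ^^ (p - j mod p + i)) x"
      unfolding funpow_add using i by simp
    finally have y: "y = (F ^^ (p - j mod p + i)) x" .
    show ?thesis
    proof
      fix w assume "w \<in> orb y"
      then obtain k where "w = (F ^^ k) y" by (auto simp: orb_def)
      then have "w = (F ^^ (k + (p - j mod p + i))) x" by (simp only: funpow_add[of k] o_apply y)
      then show "w \<in> orb x" by (auto simp: orb_def)
    qed
  qed
  have union: "\<Union> (orb ` A) = A"
  proof (intro equalityI subsetI)
    fix x assume "x \<in> A"
    moreover have "x \<in> orb x" unfolding orb_def by (rule range_eqI[of _ _ 0]) simp
    ultimately show "x \<in> \<Union> (orb ` A)" by blast
  qed (use in_A in \<open>auto simp: orb_def\<close>)
  have "p dvd card (\<Union> (orb ` A))"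
  proof (rule dvd_partition)
    show "finite (\<Union> (orb ` A))" using union fin by simp
    show "\<forall>c\<in>orb ` A. p dvd card c" using card_orb by simp
    show "\<forall>c1\<in>orb ` A. \<forall>c2\<in>orb ` A. c1 \<noteq> c2 \<longrightarrow> c1 \<inter> c2 = {}"
    proof (intro ballI impI)
      fix c1 c2 assume "c1 \<in> orb ` A" "c2 \<in> orb ` A" "c1 \<noteq> c2"
      then obtain x y where xy: "x \<in> A" "y \<in> A" "c1 = orb x" "c2 = orb y" by blast
      with \<open>c1 \<noteq> c2\<close> show "c1 \<inter> c2 = {}"
        using orb_sub[of x y] orb_sub[of y x] by blast
    qed
  qed
  then show ?thesis using union by simp
qed

section \<open>Extensions of odd prime degree\<close>

lemma poly_R_poly: "poly (R_poly d a) x = (\<Sum>i\<le>d. a i * x ^ (2 ^ i))"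
  by (simp add: R_poly_def poly_sum poly_monom)

lemma poly_f_poly: "poly (f_poly d a) x = x * poly (R_poly d a) x"
  by (simp add: f_poly_def)

lemma poly_R_tilde:
  "poly (R_tilde d a) x =
     (\<Sum>i\<le>d. a i ^ (2 ^ d) * x ^ (2 ^ (d + i)) + a i ^ (2 ^ (d - i)) * x ^ (2 ^ (d - i)))"
  by (simp add: R_tilde_def poly_sum poly_monom)

text \<open>The trace is Frobenius-invariant. Applying the \<open>d\<close>-th Frobenius iterate to the summands of
  \<open>x * R z\<close>, and the \<open>(d - i)\<close>-th to the \<open>i\<close>-th summand of \<open>z * R x\<close>, puts \<open>x ^ (2 ^ d)\<close> into every term; its
  cofactor is \<open>R_tilde\<close> at \<open>z\<close>.\<close>

lemma polar_form_eq_R_tilde: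
  fixes a :: "nat \<Rightarrow> 'k::field"
  assumes char2: "CHAR('k) = 2" and coeffs: "\<And>i. i \<le> d \<Longrightarrow> a i \<in> GF2 s"
    and x: "x \<in> GF2 s" and z: "z \<in> GF2 s"
  shows "abs_trace s (x * poly (R_poly d a) z + z * poly (R_poly d a) x) =
         abs_trace s (x ^ (2 ^ d) * poly (R_tilde d a) z)"
proof -
  note tr_add = abs_trace_add[OF char2] and tr_sum = abs_trace_sum[OF char2]
  have 1: "abs_trace s (x * (a i * z ^ (2 ^ i))) =
        abs_trace s (x ^ (2 ^ d) * (a i ^ (2 ^ d) * z ^ (2 ^ (d + i))))" if "i \<le> d" for i
  proof -
    have "x * (a i * z ^ (2 ^ i)) \<in> GF2 s"
      using that x z coeffs by (intro GF2_mult GF2_power) auto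
    from abs_trace_frobenius[OF this, of d] show ?thesis
      by (simp add: power_mult_distrib frobenius_iterate add.commute)
  qed
  have 2: "abs_trace s (z * (a i * x ^ (2 ^ i))) =
        abs_trace s (x ^ (2 ^ d) * (a i ^ (2 ^ (d - i)) * z ^ (2 ^ (d - i))))" if "i \<le> d" for i
  proof -
    have "z * (a i * x ^ (2 ^ i)) \<in> GF2 s"
      using that x z coeffs by (intro GF2_mult GF2_power) auto
    from abs_trace_frobenius[OF this, of "d - i"] that show ?thesis
      by (simp add: power_mult_distrib frobenius_iterate mult_ac)
  qed
  show ?thesis
    unfolding poly_R_poly poly_R_tilde
    by (simp add: sum_distrib_left tr_add tr_sum distrib_left 1 2 sum.distrib)
qed

text \<open>Every \<open>y\<close> in the field is of the form \<open>x ^ (2 ^ d)\<close>, so \<open>R_tilde\<close> at \<open>z\<close> is orthogonal to the whole field under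
  the trace form.\<close>

lemma polar_form_radical:
  fixes a :: "nat \<Rightarrow> 'k::alg_closed_field"
  assumes char2: "CHAR('k) = 2" and s: "s \<ge> 1" and coeffs: "\<And>i. i \<le> d \<Longrightarrow> a i \<in> GF2 s"
    and z: "z \<in> GF2 s"
    and rad: "\<And>x. x \<in> GF2 s \<Longrightarrow>
      abs_trace s (x * poly (R_poly d a) z + z * poly (R_poly d a) x) = 0"
  shows "poly (R_tilde d a) z = 0"
proof (rule abs_trace_nondegenerate[OF char2 s])
  show "poly (R_tilde d a) z \<in> GF2 s"
    unfolding poly_R_tilde
    using z coeffs by (intro GF2_sum[OF char2] GF2_add[OF char2] GF2_mult GF2_power) auto
  fix y :: 'k assume y: "y \<in> GF2 s"
  \<comment> \<open>The inverse of the \<open>d\<close>-th Frobenius iterate, whose order divides \<open>s\<close>.\<close>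
  define x where "x = y ^ (2 ^ (s * d - d))"
  have "d \<le> s * d" using s by simp
  then have "x ^ (2 ^ d) = y"
    using GF2_frobenius_multiple[OF y] by (simp add: x_def frobenius_iterate)
  moreover have "x \<in> GF2 s" using y by (simp add: x_def GF2_power)
  ultimately show "abs_trace s (y * poly (R_tilde d a) z) = 0"
    using polar_form_eq_R_tilde[where d = d and a = a and x = x, OF char2 coeffs _ z] rad[of x] by simp
qed


text \<open>An extension of odd prime degree \<open>p\<close> of the field with \<open>2 ^ r\<close> elements. The last assumption says that the
  radical of the polar form of \<open>x \<mapsto> Tr (x * R x)\<close> does not grow in the extension.\<close>

locale odd_prime_extension =
  fixes a :: "nat \<Rightarrow> 'k::alg_closed_field" and d r p :: nat
  assumes char2: "CHAR('k) = 2"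
    and r: "r \<ge> 1"
    and p: "prime p" "odd p"
    and coeffs: "\<And>i. i \<le> d \<Longrightarrow> a i \<in> GF2 r"
    and radical_descends: "\<And>x. x \<in> GF2 (r * p) \<Longrightarrow> poly (R_tilde d a) x = 0 \<Longrightarrow> x \<in> GF2 r"
begin

definition R :: "'k \<Rightarrow> 'k" where
  "R x = poly (R_poly d a) x"

definition sign :: "'k \<Rightarrow> int" where
  "sign x = add_char (abs_trace (r * p) (x * R x))"

text \<open>The orthogonal complement of the base field inside the extension.\<close>

definition V :: "'k set" where
  "V = {x \<in> GF2 (r * p). rel_trace r p x = 0}"

lemma rp: "r * p \<ge> 1"
  using r prime_gt_0_nat[OF p(1)] by simp

lemma finite_extension: "finite (GF2 (r * p) :: 'k set)"
  by (rule card_GF2(1)[OF char2 rp])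

lemma base_subset: "GF2 r \<subseteq> (GF2 (r * p) :: 'k set)"
  by (rule GF2_dvd) simp

lemma R_add: "R (x + y) = R x + R y"
  by (simp add: R_def poly_R_poly frobenius_add[OF char2] distrib_left sum.distrib)

lemma R_0 [simp]: "R 0 = 0"
  by (simp add: R_def poly_R_poly power_0_left)

lemma R_sum: "R (\<Sum>i\<in>I. g i) = (\<Sum>i\<in>I. R (g i))"
  by (induction I rule: infinite_finite_induct) (simp_all add: R_add)

lemma R_in_base: "x \<in> GF2 r \<Longrightarrow> R x \<in> GF2 r"
  unfolding R_def poly_R_poly using coeffs
  by (intro GF2_sum[OF char2] GF2_mult GF2_power) auto

lemma coeffs_extension: "i \<le> d \<Longrightarrow> a i \<in> GF2 (r * p)"
  using coeffs base_subset by blast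

lemma R_in_extension: "x \<in> GF2 (r * p) \<Longrightarrow> R x \<in> GF2 (r * p)"
  unfolding R_def poly_R_poly using coeffs_extension
  by (intro GF2_sum[OF char2] GF2_mult GF2_power) auto

lemma R_frobenius: "R (x ^ (2 ^ (r * i))) = R x ^ (2 ^ (r * i))"
proof -
  have "(a j * x ^ (2 ^ j)) ^ (2 ^ (r * i)) = a j * (x ^ (2 ^ (r * i))) ^ (2 ^ j)" if "j \<le> d" for j
    using GF2_frobenius_multiple[OF coeffs[OF that], of i]
    by (simp add: power_mult_distrib frobenius_iterate add.commute)
  then show ?thesis
    by (simp add: R_def poly_R_poly frobenius_sum[OF char2])
qed

lemma rel_trace_add: "rel_trace r p (x + y :: 'k) = rel_trace r p x + rel_trace r p y"
  by (simp add: rel_trace_def frobenius_add[OF char2] sum.distrib)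

lemma rel_trace_base: "c \<in> GF2 r \<Longrightarrow> rel_trace r p (c * x) = c * (rel_trace r p x :: 'k)"
  by (simp add: rel_trace_def power_mult_distrib GF2_frobenius_multiple sum_distrib_left)

text \<open>The degree \<open>p\<close> is odd, so the relative trace is a projection onto the base field.\<close>

lemma rel_trace_of_base: "c \<in> GF2 r \<Longrightarrow> rel_trace r p c = (c :: 'k)"
  by (simp add: rel_trace_def GF2_frobenius_multiple char2_of_odd[OF char2 p(2)])

lemma rel_trace_R: "rel_trace r p (R x) = R (rel_trace r p x)"
  by (simp add: rel_trace_def R_sum R_frobenius)

lemma rel_trace_in_base:
  assumes "(x :: 'k) \<in> GF2 (r * p)"
  shows "rel_trace r p x \<in> GF2 r"
proof -
  have "rel_trace r p x ^ (2 ^ r) + x = (\<Sum>i<p. x ^ (2 ^ (r * Suc i))) + x ^ (2 ^ (r * 0))"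
    by (simp add: rel_trace_def frobenius_sum[OF char2] frobenius_iterate add.commute)
  also have "\<dots> = (\<Sum>i<Suc p. x ^ (2 ^ (r * i)))"
    by (subst sum.lessThan_Suc_shift) simp
  also have "\<dots> = rel_trace r p x + x"
    using assms by (simp add: rel_trace_def GF2_def)
  finally show ?thesis by (simp add: GF2_def)
qed

lemma V_subset: "V \<subseteq> GF2 (r * p)" and finite_V: "finite V" and zero_in_V: "0 \<in> V"
  and V_add: "x \<in> V \<Longrightarrow> y \<in> V \<Longrightarrow> x + y \<in> V"
  and base_inter_V: "x \<in> V \<Longrightarrow> x \<in> GF2 r \<Longrightarrow> x = 0"
  using finite_extension
  by (auto simp: V_def rel_trace_add GF2_add[OF char2] rel_trace_of_base)

lemma bij_base_times_V:
  "bij_betw (\<lambda>(c, v). c + v) (GF2 r \<times> V) (GF2 (r * p))"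
proof (rule bij_betwI[where g = "\<lambda>x. (rel_trace r p x, x + rel_trace r p x)"])
  show "(\<lambda>(c, v). c + v) \<in> GF2 r \<times> V \<rightarrow> GF2 (r * p)"
    using base_subset V_subset by (auto intro!: GF2_add[OF char2])
  show "(\<lambda>x. (rel_trace r p x, x + rel_trace r p x)) \<in> GF2 (r * p) \<rightarrow> GF2 r \<times> V"
    using base_subset rel_trace_in_base
    by (auto simp: V_def rel_trace_add rel_trace_of_base char2_add_self[OF char2]
        intro!: GF2_add[OF char2])
  show "(\<lambda>x. (rel_trace r p x, x + rel_trace r p x)) (case cv of (c, v) \<Rightarrow> c + v) = cv"
    if "cv \<in> GF2 r \<times> V" for cv
    using that char2_add_self[OF char2]
    by (auto simp: V_def rel_trace_add rel_trace_of_base add.commute add.left_commute)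
  show "(case (rel_trace r p x, x + rel_trace r p x) of (c, v) \<Rightarrow> c + v) = x"
    if "x \<in> GF2 (r * p)" for x :: 'k
    using char2_add_self[OF char2] by (simp add: add.left_commute)
qed

lemma card_V: "card V = 2 ^ (r * (p - 1))"
proof -
  have "2 ^ r * card V = (2::nat) ^ (r * p)"
    using bij_betw_same_card[OF bij_base_times_V] card_GF2(2)[OF char2] r rp
    by (simp add: card_cartesian_product)
  also have "r * p = r + r * (p - 1)"
    using prime_gt_0_nat[OF p(1)] by (cases p) simp_all
  finally show ?thesis by (simp add: power_add)
qed

text \<open>Take the trace in two stages. The relative trace is linear over the base field and commutes with \<open>R\<close>, whose
  coefficients lie there, so it annihilates both summands.\<close>

lemma orthogonal:
  assumes c: "c \<in> GF2 r" and v: "v \<in> V"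
  shows "abs_trace (r * p) (c * R v + v * R c) = 0"
proof -
  have "rel_trace r p (R v) = 0" "rel_trace r p v = 0"
    using v by (simp_all add: rel_trace_R V_def)
  then have "rel_trace r p (c * R v + R c * v) = 0"
    using c R_in_base[OF c] by (simp add: rel_trace_add rel_trace_base)
  then show ?thesis
    by (simp add: abs_trace_tower[OF char2] mult.commute[of v])
qed

lemma abs_trace_extension_values:
  "y \<in> GF2 (r * p) \<Longrightarrow> abs_trace (r * p) y = 0 \<or> abs_trace (r * p) (y::'k) = 1"
  by (rule abs_trace_values[OF char2])

lemma sign_add:
  assumes "x \<in> GF2 (r * p)" "z \<in> GF2 (r * p)"
  shows "sign (x + z) = sign x * sign z * add_char (abs_trace (r * p) (x * R z + z * R x))"
proof -
  let ?t = "abs_trace (r * p) :: 'k \<Rightarrow> 'k"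
  have "?t ((x + z) * R (x + z)) = (?t (x * R x) + ?t (z * R z)) + ?t (x * R z + z * R x)"
    by (simp add: R_add distrib_left distrib_right abs_trace_add[OF char2] add_ac)
  moreover have "?t (x * R x) + ?t (z * R z) = ?t (x * R x + z * R z)"
    by (simp add: abs_trace_add[OF char2])
  moreover have in_ext: "x * R x \<in> GF2 (r * p)" "z * R z \<in> GF2 (r * p)"
    "x * R x + z * R z \<in> GF2 (r * p)" "x * R z + z * R x \<in> GF2 (r * p)"
    using assms R_in_extension by (auto intro!: GF2_add[OF char2] GF2_mult)
  moreover have "add_char (?t (x * R x + z * R z) + ?t (x * R z + z * R x)) =
      add_char (?t (x * R x + z * R z)) * add_char (?t (x * R z + z * R x))"
    by (intro add_char_add[OF char2] abs_trace_extension_values in_ext)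
  moreover have "add_char (?t (x * R x) + ?t (z * R z)) =
      add_char (?t (x * R x)) * add_char (?t (z * R z))"
    by (intro add_char_add[OF char2] abs_trace_extension_values in_ext)
  ultimately show ?thesis
    by (simp only: sign_def)
qed

lemma sum_sign_factor:
  "(\<Sum>x\<in>GF2 (r * p). sign x) =
     (\<Sum>c\<in>GF2 r. add_char (abs_trace r (c * R c))) * (\<Sum>v\<in>V. sign v)"
proof -
  have "sign (c + v) = add_char (abs_trace r (c * R c)) * sign v" if "c \<in> GF2 r" "v \<in> V" for c v
  proof -
    have "sign c = add_char (abs_trace r (c * R c))"
      unfolding sign_def abs_trace_tower[OF char2]
      using rel_trace_of_base[OF GF2_mult[OF that(1) R_in_base[OF that(1)]]] by simp
    then show ?thesis
      using sign_add[of c v] that base_subset V_subset orthogonal[OF that] by auto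
  qed
  then show ?thesis
    unfolding sum_product sum.cartesian_product
    by (subst sum.reindex_bij_betw[OF bij_base_times_V, symmetric]) (auto intro!: sum.cong)
qed

text \<open>An element of \<open>V\<close> orthogonal to \<open>V\<close> is orthogonal to the whole extension, hence a root of
  \<open>R_tilde\<close>. Such a root lies in the base field, which meets \<open>V\<close> only in \<open>0\<close>.\<close>

lemma sum_sign_V_square: "(\<Sum>v\<in>V. sign v)\<^sup>2 = 2 ^ (r * (p - 1))"
proof -
  have "(\<Sum>v\<in>V. sign v)\<^sup>2 = int (card V)"
  proof (rule nondegenerate_quadratic_sum_square[OF finite_V zero_in_V V_add,
        where b = "\<lambda>x z. add_char (abs_trace (r * p) (x * R z + z * R x))"])
    show "sign 0 = 1" by (simp add: sign_def)
    show "sign x * sign x = 1" for x by (simp add: sign_def)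
    show "sign (x + z) = sign x * sign z * add_char (abs_trace (r * p) (x * R z + z * R x))"
      if "x \<in> V" "z \<in> V" for x z
      using that V_subset by (intro sign_add) auto
    show "add_char (abs_trace (r * p) ((x + y) * R z + z * R (x + y))) =
        add_char (abs_trace (r * p) (x * R z + z * R x)) *
        add_char (abs_trace (r * p) (y * R z + z * R y))"
      if "x \<in> V" "y \<in> V" "z \<in> V" for x y z
    proof -
      have "(x + y) * R z + z * R (x + y) = (x * R z + z * R x) + (y * R z + z * R y)"
        by (simp add: R_add algebra_simps)
      moreover have "x * R z + z * R x \<in> GF2 (r * p)" "y * R z + z * R y \<in> GF2 (r * p)"
        using that V_subset R_in_extension by (auto intro!: GF2_add[OF char2] GF2_mult)
      ultimately show ?thesis
        by (simp only: abs_trace_add[OF char2, of _ "x * R z + z * R x"])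
          (intro add_char_add[OF char2] abs_trace_extension_values)
    qed
    show "\<exists>x\<in>V. add_char (abs_trace (r * p) (x * R z + z * R x)) = - 1"
      if z: "z \<in> V" "z \<noteq> 0" for z
    proof (rule ccontr)
      assume "\<not> ?thesis"
      then have zero_V: "abs_trace (r * p) (x * R z + z * R x) = 0" if "x \<in> V" for x
        using that by (auto simp: add_char_def split: if_splits)
      have "abs_trace (r * p) (x * R z + z * R x) = 0" if "x \<in> GF2 (r * p)" for x
      proof -
        have "x \<in> (\<lambda>(c, v). c + v) ` (GF2 r \<times> V)"
          using \<open>x \<in> GF2 (r * p)\<close> bij_betw_imp_surj_on[OF bij_base_times_V] by simp
        then obtain c v where cv: "c \<in> GF2 r" "v \<in> V" "x = c + v" by auto
        have "x * R z + z * R x = (c * R z + z * R c) + (v * R z + z * R v)"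
          by (simp add: cv(3) R_add algebra_simps)
        then show ?thesis
          using orthogonal[OF cv(1) z(1)] zero_V[OF cv(2)] by (simp only: abs_trace_add[OF char2]) simp
      qed
      then have "poly (R_tilde d a) z = 0"
        using z V_subset coeffs_extension
        by (intro polar_form_radical[OF char2 rp]) (auto simp: R_def)
      then show False
        using radical_descends base_inter_V z V_subset by blast
    qed
  qed
  then show ?thesis by (simp add: card_V)
qed

text \<open>The \<open>r\<close>-th Frobenius iterate has order dividing \<open>p\<close> on \<open>V\<close>, preserves the signs, and has no fixed point on
  \<open>V\<close> except \<open>0\<close>. The nonzero elements of either sign therefore come in orbits of length \<open>p\<close>.\<close>

lemma sum_sign_V_cong: "[(\<Sum>v\<in>V. sign v) = 1] (mod int p)"
proof -
  define F :: "'k \<Rightarrow> 'k" where "F x = x ^ (2 ^ r)" for x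
  have F_iter: "(F ^^ i) x = x ^ (2 ^ (r * i))" for i x
    by (induction i) (simp_all add: F_def frobenius_iterate add.commute)
  have F_V: "F x \<in> V - {0}" if "x \<in> V - {0}" for x
  proof -
    have "rel_trace r p (F x) = rel_trace r p x ^ (2 ^ r)"
      by (simp add: rel_trace_def F_def frobenius_sum[OF char2] frobenius_iterate add.commute)
    then show ?thesis
      using that by (auto simp: V_def F_def power_0_left intro: GF2_power)
  qed
  have sign_F: "sign (F x) = sign x" if "x \<in> V" for x
  proof -
    have "x * R x \<in> GF2 (r * p)"
      using that V_subset R_in_extension by (auto intro!: GF2_mult)
    moreover have "F x * R (F x) = (x * R x) ^ (2 ^ r)"
      using R_frobenius[of x 1] by (simp add: F_def power_mult_distrib)
    ultimately show ?thesis
      by (simp add: sign_def abs_trace_frobenius)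
  qed
  have dvd: "p dvd card {x \<in> V - {0}. sign x = s}" for s
  proof (rule prime_dvd_card_free_action[OF _ p(1), where F = F])
    show "finite {x \<in> V - {0}. sign x = s}" using finite_V by simp
    fix x assume x: "x \<in> {x \<in> V - {0}. sign x = s}"
    show "F x \<in> {x \<in> V - {0}. sign x = s}" using x F_V sign_F by auto
    show "(F ^^ p) x = x" using x V_subset by (auto simp: F_iter GF2_def)
    show "F x \<noteq> x" using x base_inter_V[of x] by (auto simp: F_def GF2_def)
  qed
  have "(\<Sum>v\<in>V - {0}. sign v) =
      (\<Sum>v\<in>{x \<in> V - {0}. sign x = 1} \<union> {x \<in> V - {0}. sign x = - 1}. sign v)"
    by (intro sum.cong) (auto simp: sign_def add_char_def)
  also have "\<dots> = (\<Sum>v | v \<in> V - {0} \<and> sign v = 1. sign v) + (\<Sum>v | v \<in> V - {0} \<and> sign v = - 1. sign v)"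
    using finite_V by (intro sum.union_disjoint) auto
  also have "\<dots> = int (card {x \<in> V - {0}. sign x = 1}) - int (card {x \<in> V - {0}. sign x = - 1})"
    by simp
  finally have "int p dvd (\<Sum>v\<in>V - {0}. sign v)"
    using dvd by (simp add: dvd_diff)
  moreover have "(\<Sum>v\<in>V. sign v) = 1 + (\<Sum>v\<in>V - {0}. sign v)"
    using sum.remove[OF finite_V zero_in_V, of sign] by (simp add: sign_def)
  ultimately show ?thesis by (simp add: cong_iff_dvd_diff)
qed

end

text \<open>The sum over \<open>V\<close> is known up to sign by its square; its residue modulo \<open>p\<close> picks the sign, since \<open>1\<close> and
  \<open>- 1\<close> differ modulo an odd prime.\<close>

lemma (in odd_prime_extension) sum_sign_extension:
  assumes "odd r"
  shows "(\<Sum>x\<in>GF2 (r * p). sign x) =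
    chi8 p * 2 ^ (r * ((p - 1) div 2)) * (\<Sum>c\<in>GF2 r. add_char (abs_trace r (c * R c)))"
proof -
  define h where "h = (p - 1) div 2"
  define S where "S = (\<Sum>v\<in>V. sign v)"
  have p1: "p - 1 = 2 * h" using p(2) by (auto simp: h_def elim!: oddE)
  have p3: "p > 2" using p prime_ge_2_nat[of p] by (cases "p = 2") auto
  have chi: "chi8 p = 1 \<or> chi8 p = - 1" by (rule chi8_values[OF p(2)])
  have "S\<^sup>2 = (2 ^ (r * h))\<^sup>2"
    unfolding S_def sum_sign_V_square p1 by (simp add: power_even_eq mult.left_commute flip: power_mult)
  then have S: "S = 2 ^ (r * h) \<or> S = - (2 ^ (r * h))"
    by (simp add: power2_eq_iff)
  have "[(2 ^ h) ^ r = chi8 p ^ r] (mod int p)"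
    by (intro cong_pow two_power_half_cong_chi8[OF p, folded h_def])
  moreover have "chi8 p ^ r = chi8 p" using chi \<open>odd r\<close> by auto
  ultimately have pow: "[2 ^ (r * h) = chi8 p] (mod int p)"
    by (simp add: mult.commute flip: power_mult)
  have not_dvd: "\<not> int p dvd 2" using p3 by (auto dest: zdvd_imp_le)
  have S1: "[S = 1] (mod int p)" using sum_sign_V_cong by (simp add: S_def)
  have "S = chi8 p * 2 ^ (r * h)"
  proof (rule ccontr)
    assume neq: "S \<noteq> chi8 p * 2 ^ (r * h)"
    then have "S = - chi8 p * 2 ^ (r * h)" using S chi by auto
    moreover have "[- chi8 p * 2 ^ (r * h) = - chi8 p * chi8 p] (mod int p)"
      by (rule cong_mult[OF cong_refl pow])
    moreover have "- chi8 p * chi8 p = - 1" using chi by auto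
    ultimately have "[- 1 = 1] (mod int p)" using S1 by (metis cong_sym cong_trans)
    then show False using not_dvd by (simp add: cong_iff_dvd_diff)
  qed
  then show ?thesis
    using sum_sign_factor by (simp add: S_def h_def mult.commute)
qed

lemma exp_sum_eq_add_char:
  "exp_sum m (f_poly d a) n =
     (\<Sum>x\<in>GF2 (m * n). add_char (abs_trace (m * n) (x * poly (R_poly d a) x)))"
  by (simp add: exp_sum_def add_char_def poly_f_poly)

text \<open>The normalisation by powers of \<open>\<surd>2\<close> absorbs the absolute value of the sum over the complement, so only
  the sign \<open>chi8 p\<close> remains.\<close>

lemma exp_sum_star_prime_step:
  fixes a :: "nat \<Rightarrow> 'k::alg_closed_field"
  assumes char2: "CHAR('k) = 2" and m: "odd m" and n: "odd n" and p: "prime p" "odd p"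
    and coeffs: "\<And>i. i \<le> d \<Longrightarrow> a i \<in> GF2 m"
    and radical: "\<And>x. x \<in> GF2 (m * (n * p)) \<Longrightarrow> poly (R_tilde d a) x = 0 \<Longrightarrow> x \<in> GF2 (m * n)"
  shows "exp_sum_star m (f_poly d a) (n * p) = of_int (chi8 p) * exp_sum_star m (f_poly d a) n"
proof -
  interpret odd_prime_extension a d "m * n" p
  proof
    show "1 \<le> m * n" using m n by (cases m; cases n) auto
    show "a i \<in> GF2 (m * n)" if "i \<le> d" for i
      using coeffs[OF that] GF2_dvd[of m "m * n"] by auto
    show "x \<in> GF2 (m * n)" if "x \<in> GF2 (m * n * p)" "poly (R_tilde d a) x = 0" for x
      using radical that by (simp add: mult.assoc)
  qed (use char2 p in auto)
  define h where "h = (p - 1) div 2"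
  have p_eq: "p = 2 * h + 1" using p(2) by (auto simp: h_def elim!: oddE)
  have "exp_sum m (f_poly d a) (n * p) =
      chi8 p * 2 ^ (m * n * h) * exp_sum m (f_poly d a) n"
    using sum_sign_extension m n
    by (simp add: exp_sum_eq_add_char sign_def R_def h_def mult.assoc)
  moreover have "sqrt 2 ^ (m * (n * p)) = sqrt 2 ^ (m * n) * 2 ^ (m * n * h)"
  proof -
    have "m * (n * p) = m * n + 2 * (m * n * h)" by (simp add: p_eq algebra_simps)
    then show ?thesis by (simp add: power_add power_mult)
  qed
  ultimately show ?thesis
    by (simp add: exp_sum_star_def field_simps)
qed

text \<open>Climb from \<open>gcd n N'\<close> to \<open>n\<close> by one odd prime at a time. No new root of \<open>R_tilde\<close> appears on the way: all roots lie
  in the field of degree \<open>m * N\<close>, which meets the fields along the chain in the one of degree \<open>m * gcd n N'\<close>, as \<open>n\<close> is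
  odd. Each step multiplies both factors by the sign \<open>chi8 p\<close> and so preserves their product.\<close>

lemma twisted_exp_sum_star_gcd:
  fixes a :: "nat \<Rightarrow> 'k::alg_closed_field"
  assumes char2: "CHAR('k) = 2" and m: "odd m"
    and coeffs: "\<And>i. i \<le> d \<Longrightarrow> a i \<in> GF2 m"
    and roots: "\<And>x. poly (R_tilde d a) x = 0 \<Longrightarrow> x \<in> GF2 (m * N)"
    and N: "N = 2 ^ e * N'" and n: "odd n"
  shows "of_int (chi8 n) * exp_sum_star m (f_poly d a) n =
    of_int (chi8 (gcd n N')) * exp_sum_star m (f_poly d a) (gcd n N')"
  using n
proof (induction n rule: less_induct)
  case (less n)
  define g where "g = gcd n N'"
  have n0: "n > 0" using less.prems by (cases n) auto
  obtain k where k: "n = g * k" unfolding g_def by (metis gcd_dvd1 dvdE)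
  show ?case
  proof (cases "k = 1")
    case True
    then show ?thesis using k by (simp add: g_def)
  next
    case False
    then obtain p where p: "prime p" "p dvd k" using prime_factor_nat by blast
    then obtain j where j: "k = j * p" by (metis dvdE mult.commute)
    define n' where "n' = g * j"
    have n': "n = n' * p" by (simp add: n'_def k j)
    have odd: "odd n'" "odd p" using less.prems n' by auto
    have "n' < n" using n' n0 prime_gt_1_nat[OF p(1)] by simp
    have gcd': "gcd n' N' = g"
    proof (rule dvd_antisym)
      show "gcd n' N' dvd g" unfolding g_def n' by (simp add: dvd_mult2)
      show "g dvd gcd n' N'" by (simp add: n'_def) (simp add: g_def)
    qed
    have step: "exp_sum_star m (f_poly d a) (n' * p) = of_int (chi8 p) * exp_sum_star m (f_poly d a) n'"
    proof (rule exp_sum_star_prime_step[OF char2 m odd(1) p(1) odd(2) coeffs])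
      fix x :: 'k assume x: "x \<in> GF2 (m * (n' * p))" "poly (R_tilde d a) x = 0"
      have "gcd (m * n) (m * N) = m * gcd n N" by (simp add: gcd_mult_distrib_nat)
      moreover have "gcd n N = g"
      proof -
        have "coprime n (2 ^ e)" using less.prems by simp
        then show ?thesis
          unfolding N g_def by (rule gcd_mult_right_left_cancel)
      qed
      ultimately have "x \<in> GF2 (m * g)"
        using GF2_gcd[of x "m * n" "m * N"] x roots n' by simp
      then show "x \<in> GF2 (m * n')"
        using GF2_dvd[of "m * g" "m * n'"] by (auto simp: n'_def)
    qed
    have "chi8 p * chi8 p = 1" using chi8_values[OF odd(2)] by auto
    then have chi: "chi8 n * chi8 p = chi8 n'"
      by (simp add: n' chi8_mult mult.assoc)
    have "of_int (chi8 n) * exp_sum_star m (f_poly d a) n =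
        of_int (chi8 n * chi8 p) * exp_sum_star m (f_poly d a) n'"
      using step by (simp add: n')
    also have "\<dots> = of_int (chi8 n') * exp_sum_star m (f_poly d a) n'"
      by (simp add: chi)
    also have "\<dots> = of_int (chi8 g) * exp_sum_star m (f_poly d a) g"
      using less.IH[OF \<open>n' < n\<close> odd(1)] by (simp add: gcd')
    finally show ?thesis by (simp add: g_def)
  qed
qed

section \<open>Roots of unity\<close>

lemma zeta_power: "zeta l ^ k = cis (2 * pi * real k / real l)"
  by (simp add: zeta_def DeMoivre mult_ac)

lemma zeta_nonzero [simp]: "zeta l \<noteq> 0"
  by (simp add: zeta_def)

lemma zeta_power_self: "l > 0 \<Longrightarrow> zeta l ^ l = 1"
  by (simp add: zeta_power)

lemma zeta_power_mod: "l > 0 \<Longrightarrow> zeta l ^ (k mod l) = zeta l ^ k"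
proof -
  assume "l > 0"
  have "zeta l ^ k = zeta l ^ (l * (k div l) + k mod l)" by simp
  also have "\<dots> = zeta l ^ (k mod l)"
    unfolding power_add power_mult using \<open>l > 0\<close> by (simp add: zeta_power_self)
  finally show ?thesis by simp
qed

lemma zeta_power_eq_iff:
  assumes "l > 0"
  shows "zeta l ^ i = zeta l ^ j \<longleftrightarrow> i mod l = j mod l"
proof
  assume "zeta l ^ i = zeta l ^ j"
  then have "zeta l ^ (i mod l) = zeta l ^ (j mod l)"
    by (simp add: zeta_power_mod assms)
  then show "i mod l = j mod l"
    using bij_betw_imp_inj_on[OF Complex.bij_betw_roots_unity[OF assms]] assms
    by (auto simp: zeta_power inj_on_def)
next
  assume "i mod l = j mod l"
  then show "zeta l ^ i = zeta l ^ j"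
    using zeta_power_mod[OF assms] by metis
qed

lemma zeta_mult_power: "k > 0 \<Longrightarrow> zeta (l * k) ^ (j * k) = zeta l ^ j"
  by (simp add: zeta_power mult.assoc)

text \<open>Reading both roots at the common level \<open>l * k\<close> gives \<open>i * k = j * l\<close>, that is, two reduced
  fractions \<open>i / l = j / k\<close>.\<close>

lemma primitive_root_unique:
  assumes i: "i \<in> totatives l" and j: "j \<in> totatives k" and eq: "zeta l ^ i = zeta k ^ j"
  shows "l = k \<and> i = j"
proof -
  have pos: "0 < i" "i \<le> l" "coprime i l" "0 < j" "j \<le> k" "coprime j k"
    using i j by (auto simp: in_totatives_iff)
  then have lk: "0 < l" "0 < k" by auto
  have "zeta (l * k) ^ (i * k) = zeta (l * k) ^ (j * l)"
    using zeta_mult_power[OF lk(2), of l i] zeta_mult_power[OF lk(1), of k j] eq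
    by (simp add: mult.commute)
  then have mod: "(i * k) mod (l * k) = (j * l) mod (l * k)"
    using lk by (simp add: zeta_power_eq_iff)
  have "i * k \<le> l * k" "j * l \<le> l * k" "0 < i * k" "0 < j * l"
    using pos lk by simp_all
  then have eq: "i * k = j * l"
    using mod by (metis le_neq_implies_less mod_less mod_self not_less_zero)
  have "l dvd k" using eq pos(3) by (metis coprime_commute coprime_dvd_mult_right_iff dvd_triv_right)
  moreover have "k dvd l" using eq pos(6) by (metis coprime_commute coprime_dvd_mult_right_iff dvd_triv_right)
  ultimately have "l = k" by (rule dvd_antisym)
  then show ?thesis using eq lk by simp
qed

text \<open>By linearity, \<open>z x ^ n\<close> may be replaced by \<open>z x * poly q (z x)\<close> for any polynomial \<open>q\<close>. Taking \<open>q\<close> to vanish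
  at all the other values of \<open>z\<close> isolates the fibre over \<open>y\<close>. The map \<open>z\<close> may fail to be injective, which is why the
  conclusion concerns sums over fibres.\<close>

lemma power_sums_determine_weights:
  fixes w z :: "'i \<Rightarrow> complex"
  assumes fin: "finite I" and sums: "\<And>n. n \<ge> 1 \<Longrightarrow> (\<Sum>x\<in>I. w x * z x ^ n) = 0" and y: "y \<noteq> 0"
  shows "(\<Sum>x | x \<in> I \<and> z x = y. w x) = 0"
proof -
  define q where "q = (\<Prod>y'\<in>z ` I - {y}. [:- y', 1:])"
  have roots: "poly q y' = 0 \<longleftrightarrow> y' \<in> z ` I - {y}" for y'
    using fin by (auto simp: q_def poly_prod)
  have "(\<Sum>x\<in>I. w x * (z x * poly q (z x))) =
      (\<Sum>x\<in>I. \<Sum>k\<le>degree q. coeff q k * (w x * z x ^ Suc k))"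
    by (simp add: poly_altdef sum_distrib_left mult_ac)
  also have "\<dots> = (\<Sum>k\<le>degree q. coeff q k * (\<Sum>x\<in>I. w x * z x ^ Suc k))"
    by (subst sum.swap) (simp only: sum_distrib_left)
  also have "\<dots> = 0"
    using sums[of "Suc _"] by (simp del: power_Suc)
  finally have "0 = (\<Sum>x\<in>I. w x * (z x * poly q (z x)))" by simp
  also have "\<dots> = (\<Sum>x | x \<in> I \<and> z x = y. w x * (z x * poly q (z x)))"
    using fin roots by (intro sum.mono_neutral_right) auto
  also have "\<dots> = (\<Sum>x | x \<in> I \<and> z x = y. w x) * (y * poly q y)"
    by (simp add: sum_distrib_right)
  finally show ?thesis using roots[of y] y by simp
qed

section \<open>Ramanujan sums\<close>

text \<open>Sorting \<open>1, \<dots>, l\<close> by the greatest common divisor with \<open>l\<close> writes a geometric sum with value \<open>0\<close> or \<open>l\<close> as the sum of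
  the Ramanujan sums of the divisors of \<open>l\<close>; induction isolates the one of \<open>l\<close> itself.\<close>

lemma ramanujan_c_in_Ints: "l > 0 \<Longrightarrow> ramanujan_c l n \<in> \<int>"
proof (induction l rule: less_induct)
  case (less l)
  define z where "z = zeta l ^ n"
  have zl: "z ^ l = 1"
    using zeta_power_self[OF less.prems] by (simp add: z_def flip: power_mult) (metis mult.commute power_mult power_one)
  have part: "(\<Sum>k | k \<in> {0<..l} \<and> gcd k l = d. z ^ k) = ramanujan_c (l div d) n" if "d dvd l" for d
  proof -
    have d: "d > 0" "l div d * d = l" using that less.prems by (auto intro: Nat.gr0I)
    have "(\<Sum>k\<in>{k \<in> {0<..l}. gcd k l = d}. z ^ k) = (\<Sum>i\<in>totatives (l div d). z ^ (i * d))"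
      by (rule sum.reindex_bij_betw[OF bij_betw_totatives_gcd_eq[OF that less.prems], symmetric])
    also have "\<dots> = ramanujan_c (l div d) n"
      unfolding ramanujan_c_def
    proof (intro sum.cong refl)
      fix i
      have "z ^ (i * d) = zeta (l div d * d) ^ ((n * i) * d)"
        unfolding d(2) by (simp add: z_def mult.assoc flip: power_mult)
      also have "\<dots> = zeta (l div d) ^ (n * i)" by (rule zeta_mult_power[OF d(1)])
      finally show "z ^ (i * d) = zeta (l div d) ^ (n * i)" .
    qed
    finally show ?thesis .
  qed
  have fin: "finite {d. d dvd l}" using less.prems by (simp add: finite_divisors_nat)
  have "(\<Sum>k\<in>{0<..l}. z ^ k) = (\<Sum>d | d dvd l. \<Sum>k | k \<in> {0<..l} \<and> gcd k l = d. z ^ k)"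
    using fin by (intro sum.group[symmetric]) auto
  also have "\<dots> = (\<Sum>d | d dvd l. ramanujan_c (l div d) n)"
    by (intro sum.cong refl) (use part in auto)
  also have "\<dots> = ramanujan_c l n + (\<Sum>d\<in>{d. d dvd l} - {1}. ramanujan_c (l div d) n)"
    using sum.remove[OF fin, of 1 "\<lambda>d. ramanujan_c (l div d) n"] by simp
  finally have "ramanujan_c l n =
      (\<Sum>k\<in>{0<..l}. z ^ k) - (\<Sum>d\<in>{d. d dvd l} - {1}. ramanujan_c (l div d) n)"
    by simp
  moreover have "(\<Sum>d\<in>{d. d dvd l} - {1}. ramanujan_c (l div d) n) \<in> \<int>"
  proof (rule Ints_sum)
    fix d assume "d \<in> {d. d dvd l} - {1}"
    then have d: "d dvd l" "d > 1" using less.prems by (auto intro: Nat.gr0I simp: Suc_lessI)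
    then show "ramanujan_c (l div d) n \<in> \<int>"
      using less.prems by (intro less.IH) (auto elim!: dvdE)
  qed
  moreover have "(\<Sum>k\<in>{0<..l}. z ^ k) \<in> \<int>"
  proof (cases "z = 1")
    case False
    have "(\<Sum>k\<in>{0<..l}. z ^ k) = (\<Sum>k<l. z ^ Suc k)"
      by (rule sum.reindex_bij_witness[of _ Suc "\<lambda>k. k - 1"]) auto
    also have "\<dots> = z * (\<Sum>k<l. z ^ k)" by (simp add: sum_distrib_left)
    also have "\<dots> = 0" using False zl by (simp add: sum_gp_strict)
    finally show ?thesis by simp
  qed simp
  ultimately show ?case by simp
qed

lemma ramanujan_c_periodic: "l > 0 \<Longrightarrow> l dvd k \<Longrightarrow> ramanujan_c l (n + k) = ramanujan_c l n"
  by (auto simp: ramanujan_c_def distrib_right power_add power_mult zeta_power_self elim!: dvdE)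

lemma ramanujan_c_coprime_mult:
  assumes l: "l > 1" and k: "coprime k l"
  shows "ramanujan_c l (k * n) = ramanujan_c l n"
proof -
  define g where "g i = k * i mod l" for i
  have maps: "g ` totatives l \<subseteq> totatives l"
  proof (intro image_subsetI)
    fix i assume "i \<in> totatives l"
    then have "coprime (g i) l" using k l by (simp add: g_def in_totatives_iff)
    moreover from this have "g i \<noteq> 0" using l by (intro notI) simp
    ultimately show "g i \<in> totatives l" using l by (simp add: in_totatives_iff g_def)
  qed
  have inj: "inj_on g (totatives l)"
  proof (rule inj_onI)
    fix i j assume ij: "i \<in> totatives l" "j \<in> totatives l" "g i = g j"
    then have "[i = j] (mod l)"
      using k by (simp add: g_def cong_def[symmetric] cong_mult_lcancel_nat)
    then show "i = j" using ij l by (simp add: cong_def totatives_less)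
  qed
  have "bij_betw g (totatives l) (totatives l)"
    using inj endo_inj_surj[OF _ maps inj] by (simp add: bij_betw_def)
  then have "ramanujan_c l n = (\<Sum>i\<in>totatives l. zeta l ^ (n * g i))"
    unfolding ramanujan_c_def by (rule sum.reindex_bij_betw[symmetric])
  also have "\<dots> = ramanujan_c l (k * n)"
    unfolding ramanujan_c_def
  proof (intro sum.cong refl)
    fix i
    show "zeta l ^ (n * g i) = zeta l ^ (k * n * i)"
      using l by (simp add: zeta_power_eq_iff g_def mod_mult_right_eq mult_ac)
  qed
  finally show ?thesis by simp
qed

text \<open>The Ramanujan sum twisted by the quadratic character of \<open>\<rat>(\<surd>2)\<close>. It is the difference of the power sums
  of the roots belonging to \<open>Phi_plus l\<close> and \<open>Phi_minus l\<close>.\<close>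

definition twisted_c :: "nat \<Rightarrow> nat \<Rightarrow> complex" where
  "twisted_c l n = (\<Sum>i\<in>totatives l. of_int (chi8 i) * zeta l ^ (n * i))"

lemma zeta_8: "zeta 8 = (1 + \<i>) / of_real (sqrt 2)"
  by (auto simp: zeta_def complex_eq_iff cos_45 sin_45 real_div_sqrt)

text \<open>The Gauss sum of \<open>chi8\<close>. Multiplication by an odd \<open>i\<close> permutes the odd residues, so only \<open>i = 1\<close> needs
  computing, with \<open>zeta 8 ^ 2 = \<i>\<close>.\<close>

lemma quadratic_gauss_sum_8:
  assumes "odd i"
  shows "(\<Sum>u\<in>{1, 3, 5, 7}. of_int (chi8 u) * zeta 8 ^ (i * u)) =
    of_int (chi8 i) * of_real (2 * sqrt 2)"
proof -
  define c where "c = i mod 8"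
  have c: "c = 1 \<or> c = 3 \<or> c = 5 \<or> c = 7"
    using assms unfolding c_def by presburger
  have sq: "zeta 8 ^ 2 = \<i>"
    by (simp add: zeta_8 power_divide power2_eq_square field_simps complex_eq_iff flip: of_real_mult)
  have odd_power: "zeta 8 ^ Suc (2 * k) = \<i> ^ k * zeta 8" for k
    by (simp add: power_mult sq)
  have "zeta 8 ^ 1 - zeta 8 ^ 3 - zeta 8 ^ 5 + zeta 8 ^ 7 = 2 * (1 - \<i>) * zeta 8"
    using odd_power[of 0] odd_power[of 1] odd_power[of 2] odd_power[of 3]
    by (simp add: eval_nat_numeral algebra_simps)
  also have "\<dots> = of_real (2 * sqrt 2)"
    by (simp add: zeta_8 field_simps complex_eq_iff flip: of_real_mult)
  finally have base: "zeta 8 ^ 1 - zeta 8 ^ 3 - zeta 8 ^ 5 + zeta 8 ^ 7 = of_real (2 * sqrt 2)" .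
  have red: "zeta 8 ^ (i * u) = zeta 8 ^ (c * u mod 8)" for u
    unfolding c_def by (simp add: zeta_power_eq_iff mod_mult_left_eq)
  have "chi8 i = chi8 c" by (simp add: c_def chi8_mod)
  then show ?thesis
    unfolding base[symmetric] using c by (elim disjE) (simp_all add: red chi8_def)
qed

lemma odd_totatives: "even l \<Longrightarrow> i \<in> totatives l \<Longrightarrow> odd i"
  by (auto simp: in_totatives_iff elim!: dvdE dest: coprime_common_divisor_nat)

text \<open>Expanding \<open>chi8 i\<close> by its Gauss sum removes the twist, as \<open>zeta 8\<close> is a power of \<open>zeta l\<close>. Together with the
  integrality of Ramanujan sums this shows that twisted sums are rational multiples of \<open>\<surd>2\<close>.\<close>

lemma twisted_c_eq_ramanujan:
  assumes l: "l > 0" "8 dvd l"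
  shows "of_real (2 * sqrt 2) * twisted_c l n =
    (\<Sum>u\<in>{1, 3, 5, 7}. of_int (chi8 u) * ramanujan_c l (n + u * (l div 8)))"
proof -
  obtain k where k: "l = 8 * k" using l(2) by (elim dvdE)
  have k0: "k > 0" using l k by simp
  have "of_real (2 * sqrt 2) * twisted_c l n =
      (\<Sum>i\<in>totatives l. (\<Sum>u\<in>{1, 3, 5, 7}. of_int (chi8 u) * zeta 8 ^ (i * u)) * zeta l ^ (n * i))"
    unfolding twisted_c_def sum_distrib_left
  proof (intro sum.cong refl)
    fix i assume "i \<in> totatives l"
    then have "odd i" using odd_totatives[of l i] k by simp
    then show "of_real (2 * sqrt 2) * (of_int (chi8 i) * zeta l ^ (n * i)) =
        (\<Sum>u\<in>{1, 3, 5, 7}. of_int (chi8 u) * zeta 8 ^ (i * u)) * zeta l ^ (n * i)"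
      unfolding quadratic_gauss_sum_8[OF \<open>odd i\<close>] by simp
  qed
  also have "\<dots> = (\<Sum>i\<in>totatives l. \<Sum>u\<in>{1, 3, 5, 7}. of_int (chi8 u) * zeta l ^ ((n + u * (l div 8)) * i))"
  proof (intro sum.cong refl)
    fix i
    have "zeta 8 ^ (i * u) * zeta l ^ (n * i) = zeta l ^ ((n + u * (l div 8)) * i)" for u
      using zeta_mult_power[OF k0, of 8 "i * u"] by (simp add: k algebra_simps power_add)
    then show "(\<Sum>u\<in>{1, 3, 5, 7}. of_int (chi8 u) * zeta 8 ^ (i * u)) * zeta l ^ (n * i) =
        (\<Sum>u\<in>{1, 3, 5, 7}. of_int (chi8 u) * zeta l ^ ((n + u * (l div 8)) * i))"
      by (simp only: sum_distrib_right mult.assoc)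
  qed
  also have "\<dots> = (\<Sum>u\<in>{1, 3, 5, 7}. of_int (chi8 u) * ramanujan_c l (n + u * (l div 8)))"
    by (subst sum.swap) (simp only: ramanujan_c_def sum_distrib_left)
  finally show ?thesis .
qed

lemma totatives_8: "totatives 8 = {1, 3, 5, 7}"
proof -
  have "coprime k 8 \<longleftrightarrow> odd k" for k :: nat
    using coprime_power_right_iff[of k 2 3] by simp
  then have "k \<in> totatives 8 \<longleftrightarrow> k \<in> {1, 3, 5, 7}" for k
    unfolding in_totatives_iff by (simp only: insert_iff empty_iff) presburger
  then show ?thesis by blast
qed

text \<open>The Chinese remainder theorem separates the sum into the Gauss sum of \<open>chi8\<close> and a Ramanujan sum modulo \<open>l\<close>.
  The root \<open>zeta (8 * l)\<close> splits as \<open>zeta 8 ^ l * zeta l ^ b\<close>: since \<open>l\<^sup>2 = 1\<close> modulo 8, the inverse of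
  \<open>l\<close> modulo 8 is \<open>l\<close> itself, which is where \<open>chi8 l\<close> comes from.\<close>

lemma twisted_c_8_mult:
  assumes l: "odd l" and n: "odd n"
  shows "twisted_c (8 * l) n = of_real (2 * sqrt 2) * of_int (chi8 l * chi8 n) * ramanujan_c l n"
proof (cases "l = 1")
  case True
  then show ?thesis
    using quadratic_gauss_sum_8[OF n]
    by (simp add: twisted_c_def totatives_8 ramanujan_c_def zeta_def chi8_def)
next
  case False
  with l have l1: "l > 1" by (metis One_nat_def Suc_lessI even_zero not_gr_zero)
  obtain j where j: "l = 2 * j + 1" using l oddE by blast
  obtain t where t: "l * l = 8 * t + 1"
  proof -
    have "even (j * (j + 1))" by simp
    then obtain s where "j * (j + 1) = 2 * s" by (elim evenE)
    then have "l * l = 8 * s + 1" by (simp add: j algebra_simps)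
    then show ?thesis by (rule that)
  qed
  \<comment> \<open>An inverse of 8 modulo \<open>l\<close>: the equation for \<open>t\<close> gives \<open>8 * (- t) = 1\<close> modulo \<open>l\<close>, and \<open>l - 1 = - 1\<close>.\<close>
  define b where "b = (l - 1) * t"
  have lb: "l * l + b * 8 = 1 + (8 * l) * t"
  proof -
    have "l * l + b * 8 = 1 + 8 * (t + (l - 1) * t)" by (simp add: b_def t)
    also have "t + (l - 1) * t = l * t" using l1 by (cases l) simp_all
    finally show ?thesis by simp
  qed
  have zeta_split: "zeta (8 * l) ^ x = zeta 8 ^ (l * x) * zeta l ^ (b * x)" for x
  proof -
    have "zeta 8 ^ l * zeta l ^ b = zeta (8 * l) ^ (l * l + b * 8)"
      using zeta_mult_power[of l 8 l] zeta_mult_power[of 8 l b] l1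
      by (simp add: power_add mult.commute)
    also have "\<dots> = zeta (8 * l)"
      unfolding lb power_add power_mult[of _ "8 * l" t] using l1 by (simp add: zeta_power_self)
    finally show ?thesis by (metis power_mult power_mult_distrib)
  qed
  have "coprime b l"
  proof (rule coprimeI)
    fix q assume q: "q dvd b" "q dvd l"
    have "q dvd 1 + (8 * l) * t" unfolding lb[symmetric] using q by simp
    moreover have "q dvd (8 * l) * t" using q by simp
    ultimately show "is_unit q" by (metis dvd_add_left_iff)
  qed
  have "coprime 8 l" using l coprime_power_left_iff[of 2 3 l] by simp
  have "twisted_c (8 * l) n =
      (\<Sum>x\<in>totatives (8 * l). (\<lambda>(r, s). (of_int (chi8 r) * zeta 8 ^ (n * l * r)) * zeta l ^ (b * n * s)) (x mod 8, x mod l))"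
    unfolding twisted_c_def
  proof (intro sum.cong refl)
    fix x
    have "zeta 8 ^ (n * l * (x mod 8)) = zeta 8 ^ (n * l * x)"
      by (simp add: zeta_power_eq_iff mod_mult_right_eq)
    then have "zeta 8 ^ (n * l * (x mod 8)) = zeta 8 ^ (l * (n * x))"
      by (simp only: mult_ac)
    moreover have "zeta l ^ (b * n * (x mod l)) = zeta l ^ (b * n * x)"
      using l1 by (simp add: zeta_power_eq_iff mod_mult_right_eq)
    then have "zeta l ^ (b * n * (x mod l)) = zeta l ^ (b * (n * x))"
      by (simp only: mult_ac)
    ultimately show "of_int (chi8 x) * zeta (8 * l) ^ (n * x) =
        (\<lambda>(r, s). (of_int (chi8 r) * zeta 8 ^ (n * l * r)) * zeta l ^ (b * n * s)) (x mod 8, x mod l)"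
      by (simp add: chi8_mod zeta_split)
  qed
  also have "\<dots> = (\<Sum>(r, s)\<in>totatives 8 \<times> totatives l.
      (of_int (chi8 r) * zeta 8 ^ (n * l * r)) * zeta l ^ (b * n * s))"
    by (rule sum.reindex_bij_betw[OF bij_betw_totatives[OF _ l1 \<open>coprime 8 l\<close>]]) simp
  also have "\<dots> = (\<Sum>r\<in>{1, 3, 5, 7}. of_int (chi8 r) * zeta 8 ^ (n * l * r)) * ramanujan_c l (b * n)"
    unfolding ramanujan_c_def sum_product sum.cartesian_product totatives_8 ..
  also have "\<dots> = of_int (chi8 (n * l)) * of_real (2 * sqrt 2) * ramanujan_c l n"
    using l n quadratic_gauss_sum_8[of "n * l"] ramanujan_c_coprime_mult[OF l1 \<open>coprime b l\<close>]
    by simp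
  finally show ?thesis by (simp add: chi8_mult mult_ac)
qed

section \<open>Power sums of reciprocal roots\<close>

text \<open>If \<open>F\<close> is a product of factors \<open>1 - \<alpha> * X\<close>, the logarithmic derivative \<open>F' / F\<close> has the coefficients
  \<open>- (\<Sum>\<alpha>. \<alpha> ^ Suc n)\<close>. Only \<open>s n\<close> for positive \<open>n\<close> is recorded, so \<open>s 0\<close> is unconstrained.\<close>

definition has_power_sums :: "complex fps \<Rightarrow> (nat \<Rightarrow> complex) \<Rightarrow> bool" where
  "has_power_sums F s \<longleftrightarrow> fps_deriv F = - (F * Abs_fps (\<lambda>n. s (Suc n)))"

lemma has_power_sums_1: "has_power_sums 1 (\<lambda>n. 0)"
  by (simp add: has_power_sums_def fps_zero_def[symmetric])

lemma has_power_sums_mult: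
  assumes "has_power_sums F s" "has_power_sums G t"
  shows "has_power_sums (F * G) (\<lambda>n. s n + t n)"
proof -
  have "Abs_fps (\<lambda>n. s (Suc n) + t (Suc n)) = Abs_fps (\<lambda>n. s (Suc n)) + Abs_fps (\<lambda>n. t (Suc n))"
    by (rule fps_ext) simp
  then show ?thesis using assms by (simp add: has_power_sums_def algebra_simps)
qed

lemma has_power_sums_power:
  assumes "has_power_sums F s"
  shows "has_power_sums (F ^ k) (\<lambda>n. of_nat k * s n)"
proof (induction k)
  case (Suc k)
  then show ?case
    using has_power_sums_mult[OF assms Suc] by (simp add: algebra_simps)
qed (simp add: has_power_sums_1)

lemma has_power_sums_prod:
  assumes "\<And>i. i \<in> I \<Longrightarrow> has_power_sums (F i) (s i)"
  shows "has_power_sums (\<Prod>i\<in>I. F i) (\<lambda>n. \<Sum>i\<in>I. s i n)"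
  using assms
  by (induction I rule: infinite_finite_induct) (simp_all add: has_power_sums_1 has_power_sums_mult)

lemma has_power_sums_linear: "has_power_sums (fps_of_poly [:1, - z:]) (\<lambda>n. z ^ n)"
proof -
  have "(1 - fps_const z * fps_X) * Abs_fps (\<lambda>n. z ^ Suc n) = fps_const z"
  proof (rule fps_ext)
    fix n
    show "((1 - fps_const z * fps_X) * Abs_fps (\<lambda>n. z ^ Suc n)) $ n = fps_const z $ n"
      by (cases n) (simp_all add: left_diff_distrib mult.assoc)
  qed
  moreover have "fps_of_poly [:1, - z:] = 1 - fps_const z * fps_X"
    by (simp add: fps_of_poly_pCons mult.commute)
  moreover have "fps_deriv (1 - fps_const z * fps_X) = - fps_const z" by simp
  ultimately show ?thesis by (simp only: has_power_sums_def)
qed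

lemma has_power_sums_unique:
  assumes "has_power_sums F s" "has_power_sums F t" "F \<noteq> 0" "n \<ge> 1"
  shows "s n = t n"
proof -
  have "Abs_fps (\<lambda>n. s (Suc n)) = Abs_fps (\<lambda>n. t (Suc n))"
    using assms(1-3) by (simp add: has_power_sums_def)
  then have "s (Suc k) = t (Suc k)" for k by (metis fps_nth_Abs_fps)
  then show ?thesis using assms(4) by (cases n) auto
qed

lemma L_star_nth_0: "L_star m f $ 0 = 1"
  by (simp add: L_star_def L_fun_def)

text \<open>The logarithmic derivative of an exponential is the derivative of its exponent; substituting
  \<open>T / (\<surd>2) ^ m\<close> for \<open>T\<close> normalises the exponential sums.\<close>

lemma has_power_sums_L_star:
  "has_power_sums (L_star m f) (\<lambda>n. - of_real (exp_sum_star m f n))"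
proof -
  define g where "g = Abs_fps (\<lambda>n. if n = 0 then 0 else of_int (exp_sum m f n) / of_nat n :: complex)"
  define c :: complex where "c = 1 / complex_of_real (sqrt 2 ^ m)"
  have "fps_deriv (L_fun m f) = L_fun m f * fps_deriv g"
    unfolding L_fun_def g_def[symmetric] by (subst fps_compose_deriv) (simp_all add: g_def)
  then have "fps_deriv (L_star m f) =
      ((L_fun m f * fps_deriv g) oo (fps_const c * fps_X)) * fps_const c"
    unfolding L_star_def c_def[symmetric] by (subst fps_compose_deriv) simp_all
  also have "\<dots> = L_star m f * ((fps_deriv g oo (fps_const c * fps_X)) * fps_const c)"
    unfolding L_star_def c_def[symmetric] by (subst fps_compose_mult_distrib) (simp_all add: mult.assoc)
  also have "(fps_deriv g oo (fps_const c * fps_X)) * fps_const c =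
      Abs_fps (\<lambda>n. of_real (exp_sum_star m f (Suc n)))"
  proof (rule fps_ext)
    fix n
    have "of_nat (Suc n) * (of_int (exp_sum m f (Suc n)) / of_nat (Suc n)) = (of_int (exp_sum m f (Suc n)) :: complex)"
      by (simp del: of_nat_Suc)
    then show "((fps_deriv g oo (fps_const c * fps_X)) * fps_const c) $ n =
        Abs_fps (\<lambda>n. of_real (exp_sum_star m f (Suc n))) $ n"
      by (simp add: g_def exp_sum_star_def c_def power_add power_mult power_divide power_mult_distrib
          del: of_nat_Suc)
  qed
  finally show ?thesis
    by (simp add: has_power_sums_def fps_eq_iff fps_mult_nth sum_negf)
qed

lemma has_power_sums_prod_linear:
  "has_power_sums (fps_of_poly (\<Prod>i\<in>I. [:1, - (zeta l ^ i):])) (\<lambda>n. \<Sum>i\<in>I. zeta l ^ (n * i))"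
proof -
  have "has_power_sums (\<Prod>i\<in>I. fps_of_poly [:1, - (zeta l ^ i):]) (\<lambda>n. \<Sum>i\<in>I. (zeta l ^ i) ^ n)"
    by (intro has_power_sums_prod has_power_sums_linear)
  then show ?thesis by (simp add: fps_of_poly_prod mult.commute flip: power_mult)
qed

lemma exp_sum_star_eq_power_sums:
  assumes exps: "L_exponents m f mu mu_p mu_m" and n: "n \<ge> 1"
  defines "A \<equiv> {l. l > 0 \<and> multiplicity 2 l \<le> 2 \<and> mu l \<noteq> 0}"
    and "B \<equiv> {l. l > 0 \<and> multiplicity 2 l \<ge> 3 \<and> (mu_p l \<noteq> 0 \<or> mu_m l \<noteq> 0)}"
  shows "of_real (exp_sum_star m f n) =
    - ((\<Sum>l\<in>A. of_nat (mu l) * ramanujan_c l n) +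
       (\<Sum>l\<in>B. of_nat (mu_p l) * (\<Sum>i | i \<in> totatives l \<and> chi8 i = 1. zeta l ^ (n * i)) +
               of_nat (mu_m l) * (\<Sum>i | i \<in> totatives l \<and> chi8 i = - 1. zeta l ^ (n * i))))"
proof -
  define P where "P = (\<lambda>n. (\<Sum>l\<in>A. of_nat (mu l) * ramanujan_c l n) +
       (\<Sum>l\<in>B. of_nat (mu_p l) * (\<Sum>i | i \<in> totatives l \<and> chi8 i = 1. zeta l ^ (n * i)) +
               of_nat (mu_m l) * (\<Sum>i | i \<in> totatives l \<and> chi8 i = - 1. zeta l ^ (n * i))))"
  have "L_star m f = fps_of_poly ((\<Prod>l\<in>A. Phi l ^ mu l) * (\<Prod>l\<in>B. Phi_plus l ^ mu_p l * Phi_minus l ^ mu_m l))"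
    using exps unfolding L_exponents_def A_def B_def Let_def by blast
  also have "\<dots> = (\<Prod>l\<in>A. fps_of_poly (Phi l) ^ mu l) *
      (\<Prod>l\<in>B. fps_of_poly (Phi_plus l) ^ mu_p l * fps_of_poly (Phi_minus l) ^ mu_m l)"
    by (simp add: fps_of_poly_mult fps_of_poly_prod fps_of_poly_power)
  finally have "has_power_sums (L_star m f) P"
    unfolding P_def Phi_def Phi_plus_def Phi_minus_def ramanujan_c_def
    by (simp only:) (intro has_power_sums_mult has_power_sums_prod has_power_sums_power has_power_sums_prod_linear)
  moreover have "L_star m f \<noteq> 0" using L_star_nth_0[of m f] by auto
  ultimately have "- complex_of_real (exp_sum_star m f n) = P n"
    using has_power_sums_unique[OF has_power_sums_L_star _ _ n] by blast
  then have "complex_of_real (exp_sum_star m f n) = - P n" by (simp add: equation_minus_iff)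
  then show ?thesis by (simp only: P_def)
qed

lemma plus_minus_sums:
  assumes "even l"
  shows "(\<Sum>i | i \<in> totatives l \<and> chi8 i = 1. zeta l ^ (n * i)) = (ramanujan_c l n + twisted_c l n) / 2"
    and "(\<Sum>i | i \<in> totatives l \<and> chi8 i = - 1. zeta l ^ (n * i)) = (ramanujan_c l n - twisted_c l n) / 2"
proof -
  let ?P = "\<Sum>i | i \<in> totatives l \<and> chi8 i = 1. zeta l ^ (n * i)"
  let ?M = "\<Sum>i | i \<in> totatives l \<and> chi8 i = - 1. zeta l ^ (n * i)"
  have split: "totatives l = {i. i \<in> totatives l \<and> chi8 i = 1} \<union> {i. i \<in> totatives l \<and> chi8 i = - 1}"
    using odd_totatives[OF assms] chi8_values by auto
  have 1: "ramanujan_c l n = ?P + ?M"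
    unfolding ramanujan_c_def by (subst split, rule sum.union_disjoint) auto
  have "twisted_c l n = (\<Sum>i | i \<in> totatives l \<and> chi8 i = 1. of_int (chi8 i) * zeta l ^ (n * i)) +
      (\<Sum>i | i \<in> totatives l \<and> chi8 i = - 1. of_int (chi8 i) * zeta l ^ (n * i))"
    unfolding twisted_c_def by (subst split, rule sum.union_disjoint) auto
  then have 2: "twisted_c l n = ?P - ?M" by (simp add: sum_negf)
  show "?P = (ramanujan_c l n + twisted_c l n) / 2" "?M = (ramanujan_c l n - twisted_c l n) / 2"
    using 1 2 by simp_all
qed

section \<open>Rational and irrational parts\<close>

lemma rat_square_neq_2: "(q :: rat)\<^sup>2 \<noteq> 2"
proof
  assume sq: "q\<^sup>2 = 2"
  obtain a b where ab: "quotient_of q = (a, b)" by fastforce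
  have b: "b > 0" "coprime a b" and q: "q = of_int a / of_int b"
    using quotient_of_denom_pos[OF ab] quotient_of_coprime[OF ab] quotient_of_div[OF ab] by auto
  have "(of_int (a\<^sup>2) :: rat) = of_int (2 * b\<^sup>2)"
    using sq b(1) by (simp add: q power_divide field_simps)
  then have eq: "a\<^sup>2 = 2 * b\<^sup>2" by (simp only: of_int_eq_iff)
  then have "even a" by (metis dvd_triv_left even_power pos2)
  then obtain c where "a = 2 * c" by blast
  then have "b\<^sup>2 = 2 * c\<^sup>2" using eq by (simp add: power2_eq_square)
  then have "even b" by (metis dvd_triv_left even_power pos2)
  then show False using \<open>even a\<close> b(2) by (auto dest: coprime_common_divisor)
qed

lemma sqrt_2_rational_independent:
  assumes x: "x \<in> \<rat>" and y: "y \<in> \<rat>" and eq: "x = of_real (sqrt 2) * (y :: complex)"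
  shows "x = 0 \<and> y = 0"
proof (cases "y = 0")
  case False
  have "x / y \<in> \<rat>" using x y by (rule Rats_divide)
  then obtain q where q: "x / y = of_rat q" by (auto elim: Rats_cases)
  have "of_rat (q\<^sup>2) = (x / y)\<^sup>2" by (simp add: q of_rat_power)
  also have "\<dots> = of_real ((sqrt 2)\<^sup>2)" using False by (simp add: eq del: real_sqrt_pow2)
  also have "\<dots> = of_rat 2" by simp
  finally have "q\<^sup>2 = 2" by (simp only: of_rat_eq_iff)
  then show ?thesis using rat_square_neq_2 by blast
qed (use eq in simp)

lemma twisted_c_sqrt_2:
  assumes "l > 0" "8 dvd l"
  shows "\<exists>y\<in>\<rat>. twisted_c l n = of_real (sqrt 2) * y"
proof -
  define k where "k = (\<Sum>u\<in>{1, 3, 5, 7}. of_int (chi8 u) * ramanujan_c l (n + u * (l div 8)))"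
  have "k \<in> \<int>"
    unfolding k_def using ramanujan_c_in_Ints[OF assms(1)] by (intro Ints_sum Ints_mult) auto
  then have "k / 4 \<in> \<rat>" using Ints_subset_Rats by (intro Rats_divide) auto
  moreover have "twisted_c l n = of_real (sqrt 2) * (k / 4)"
  proof -
    have "sqrt 2 * (2 * sqrt 2) = 4"
      by (subst mult.left_commute) simp
    then have "4 = complex_of_real (sqrt 2 * (2 * sqrt 2))"
      by (simp only: of_real_numeral)
    also have "\<dots> * twisted_c l n = of_real (sqrt 2) * (of_real (2 * sqrt 2) * twisted_c l n)"
      by (simp only: of_real_mult mult.assoc)
    also have "\<dots> = of_real (sqrt 2) * k"
      unfolding k_def twisted_c_eq_ramanujan[OF assms] ..
    finally show ?thesis by (simp add: mult.commute)
  qed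
  ultimately show ?thesis by blast
qed

lemma exp_sum_star_rational:
  "even (m * n) \<Longrightarrow> complex_of_real (exp_sum_star m f n) \<in> \<rat>"
  "odd (m * n) \<Longrightarrow> \<exists>y\<in>\<rat>. complex_of_real (exp_sum_star m f n) = of_real (sqrt 2) * y"
proof -
  have "sqrt 2 ^ (2 * k) = 2 ^ k" for k by (simp add: power_mult)
  note pow = this
  {
    assume "even (m * n)"
    then obtain k where "m * n = 2 * k" by (elim evenE)
    then have "complex_of_real (exp_sum_star m f n) = of_int (exp_sum m f n) / 2 ^ k"
      by (simp add: exp_sum_star_def pow)
    then show "complex_of_real (exp_sum_star m f n) \<in> \<rat>" by simp
  }
  {
    assume "odd (m * n)"
    then obtain k where k: "m * n = 2 * k + 1" by (elim oddE)
    have "exp_sum_star m f n = sqrt 2 * (of_int (exp_sum m f n) / 2 ^ (k + 1))"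
    proof -
      have "sqrt 2 * (x / 2 ^ (k + 1)) = sqrt 2 * x / (sqrt 2 * sqrt 2 * 2 ^ k)" for x :: real
        by simp
      also have "\<dots> x = x / (sqrt 2 * 2 ^ k)" for x :: real
        by (simp only: mult.assoc) simp
      finally show ?thesis by (simp add: exp_sum_star_def k pow)
    qed
    then have "complex_of_real (exp_sum_star m f n) = of_real (sqrt 2) * (of_int (exp_sum m f n) / 2 ^ (k + 1))"
      by simp
    then show "\<exists>y\<in>\<rat>. complex_of_real (exp_sum_star m f n) = of_real (sqrt 2) * y"
      by (rule bexI) simp
  }
qed

lemma eight_dvd_iff: "l > 0 \<Longrightarrow> 8 dvd l \<longleftrightarrow> multiplicity 2 (l::nat) \<ge> 3"
  using power_dvd_iff_le_multiplicity[of l 2 3] by simp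

lemma sum_sqrt_2_multiples:
  assumes "\<And>i. i \<in> I \<Longrightarrow> \<exists>y\<in>\<rat>. g i = of_real (sqrt 2) * (y :: complex)"
  shows "\<exists>y\<in>\<rat>. sum g I = of_real (sqrt 2) * y"
proof -
  obtain y where "\<And>i. i \<in> I \<Longrightarrow> y i \<in> \<rat> \<and> g i = of_real (sqrt 2) * (y i :: complex)"
    using assms by metis
  then have "sum g I = of_real (sqrt 2) * sum y I" "sum y I \<in> \<rat>"
    by (simp_all add: sum_distrib_left Rats_sum)
  then show ?thesis by blast
qed

text \<open>In the power sum of the reciprocal roots, Ramanujan sums are rational and twisted sums are rational multiples
  of \<open>\<surd>2\<close>. The exponential sum itself is of the first kind for even \<open>n\<close> and of the second for odd
  \<open>n\<close>, so the two parts can be compared separately.\<close>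

lemma exp_sum_star_twisted:
  assumes exps: "L_exponents m f mu mu_p mu_m" and m: "odd m" and n: "n \<ge> 1"
  defines "B \<equiv> {l. l > 0 \<and> multiplicity 2 l \<ge> 3 \<and> (mu_p l \<noteq> 0 \<or> mu_m l \<noteq> 0)}"
  shows "(\<Sum>l\<in>B. of_real (neg_mult mu_p mu_m l) * twisted_c l n) =
    (if even n then 0 else - of_real (exp_sum_star m f n))"
proof -
  let ?M = "neg_mult mu_p mu_m"
  define A where "A = {l. l > 0 \<and> multiplicity 2 l \<le> 2 \<and> mu l \<noteq> 0}"
  define Q where "Q = (\<Sum>l\<in>A. of_nat (mu l) * ramanujan_c l n) +
      (\<Sum>l\<in>B. (of_nat (mu_p l) + of_nat (mu_m l)) / 2 * ramanujan_c l n)"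
  define X where "X = (\<Sum>l\<in>B. of_real (?M l) * twisted_c l n)"
  have B: "l > 0" "8 dvd l" "even l" if "l \<in> B" for l
  proof -
    show "l > 0" "8 dvd l" using that eight_dvd_iff by (auto simp: B_def)
    then show "even l" by (metis dvd_trans even_numeral)
  qed
  have Rats_ramanujan: "ramanujan_c l n \<in> \<rat>" if "l > 0" for l
    using ramanujan_c_in_Ints[OF that] Ints_subset_Rats by blast
  have "Q \<in> \<rat>"
    unfolding Q_def using B Rats_ramanujan
    by (intro Rats_add Rats_sum Rats_mult) (auto simp: A_def)
  have X_sqrt: "\<exists>y\<in>\<rat>. X = of_real (sqrt 2) * y"
    unfolding X_def
  proof (rule sum_sqrt_2_multiples)
    fix l assume l: "l \<in> B"
    obtain y where y: "y \<in> \<rat>" "twisted_c l n = of_real (sqrt 2) * y"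
      using twisted_c_sqrt_2 B(1,2)[OF l] by blast
    have "?M l \<in> \<rat>" by (simp add: neg_mult_def)
    then have "complex_of_real (?M l) \<in> \<rat>" by simp
    then show "\<exists>y\<in>\<rat>. of_real (?M l) * twisted_c l n = of_real (sqrt 2) * y"
      using y by (intro bexI[of _ "of_real (?M l) * y"]) simp_all
  qed
  have "of_nat (mu_p l) * (\<Sum>i | i \<in> totatives l \<and> chi8 i = 1. zeta l ^ (n * i)) +
        of_nat (mu_m l) * (\<Sum>i | i \<in> totatives l \<and> chi8 i = - 1. zeta l ^ (n * i)) =
        (of_nat (mu_p l) + of_nat (mu_m l)) / 2 * ramanujan_c l n + of_real (?M l) * twisted_c l n"
    if l: "l \<in> B" for l
  proof -
    have "\<not> multiplicity 2 l \<le> 2" using l by (auto simp: B_def)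
    then show ?thesis
      unfolding plus_minus_sums[OF B(3)[OF l]] by (simp add: neg_mult_def field_simps)
  qed
  then have total: "of_real (exp_sum_star m f n) = - (Q + X)"
    unfolding exp_sum_star_eq_power_sums[OF exps n] A_def[symmetric] B_def[symmetric] Q_def X_def
    by (simp add: sum.distrib)
  obtain y where y: "y \<in> \<rat>" "X = of_real (sqrt 2) * y" using X_sqrt by blast
  show ?thesis
  proof (cases "even n")
    case True
    then have "- (of_real (exp_sum_star m f n) + Q) \<in> \<rat>"
      using exp_sum_star_rational(1)[of m n f] \<open>Q \<in> \<rat>\<close> by (simp only: Rats_minus_iff) (auto intro: Rats_add)
    moreover have "- (of_real (exp_sum_star m f n) + Q) = of_real (sqrt 2) * y"
      using total y(2) by simp
    ultimately show ?thesis
      using sqrt_2_rational_independent[OF _ y(1)] y(2) True by (simp add: X_def)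
  next
    case False
    then obtain z where z: "z \<in> \<rat>" "complex_of_real (exp_sum_star m f n) = of_real (sqrt 2) * z"
      using exp_sum_star_rational(2)[of m n f] m by auto
    have "- Q = of_real (sqrt 2) * (z + y)" using total y(2) z(2) by (simp add: distrib_left)
    moreover have "- Q \<in> \<rat>" "z + y \<in> \<rat>"
      using \<open>Q \<in> \<rat>\<close> y(1) z(1) by (simp_all add: Rats_add)
    ultimately have "- Q = 0"
      using sqrt_2_rational_independent by blast
    then show ?thesis using total False by (simp add: X_def)
  qed
qed

section \<open>The negative multiplicities\<close>

text \<open>Modulo \<open>k\<close> divisible by 16, passing from a unit \<open>i\<close> to \<open>i + k div 2\<close> negates \<open>zeta k ^ i\<close>, keeps \<open>i\<close> a unit and does not
  change \<open>i\<close> modulo 8.\<close>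

lemma neg_primitive_root:
  assumes k: "k > 0" "16 dvd k"
  shows "1 + k div 2 \<in> totatives k" "zeta k ^ (1 + k div 2) = - zeta k"
proof -
  obtain j where j: "k = 16 * j" using k(2) by (elim dvdE)
  have "j > 0" using j k by simp
  have "coprime (1 + 8 * j) (16 * j)"
  proof (rule coprimeI)
    fix q assume q: "q dvd 1 + 8 * j" "q dvd 16 * j"
    have "q dvd 2 * (1 + 8 * j)" using q(1) by (rule dvd_mult)
    moreover have "2 * (1 + 8 * j) = 16 * j + 2" by simp
    ultimately have "q dvd 2" using q(2) by (metis dvd_add_right_iff)
    then have "q dvd 8 * j" by (metis dvd_mult2 dvd_trans even_numeral)
    then show "is_unit q" using q(1) by (metis dvd_add_left_iff)
  qed
  then show "1 + k div 2 \<in> totatives k"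
    using \<open>j > 0\<close> by (simp add: in_totatives_iff j)
  have "zeta k ^ (k div 2) = - 1"
    using \<open>j > 0\<close> by (simp add: zeta_power j)
  then show "zeta k ^ (1 + k div 2) = - zeta k" by simp
qed

lemma zeta_square_eq_iff:
  assumes k: "k > 0" "16 dvd k"
  shows "i \<in> totatives l \<and> (zeta l ^ i)\<^sup>2 = (zeta k)\<^sup>2 \<longleftrightarrow> l = k \<and> (i = 1 \<or> i = 1 + k div 2)"
proof -
  have one: "1 \<in> totatives k" using k by simp
  have "(zeta l ^ i)\<^sup>2 = (zeta k)\<^sup>2 \<longleftrightarrow> zeta l ^ i = zeta k ^ 1 \<or> zeta l ^ i = zeta k ^ (1 + k div 2)"
    unfolding neg_primitive_root(2)[OF k] by (simp add: power2_eq_iff)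
  then show ?thesis
    using primitive_root_unique[of i l 1 k] primitive_root_unique[of i l "1 + k div 2" k]
      one neg_primitive_root(1)[OF k] by blast
qed

text \<open>At even \<open>n\<close> one sees the power sums of the squared roots. The fibre of squaring over \<open>(zeta k)\<^sup>2\<close> is
  \<open>{zeta k, - zeta k}\<close>; both roots have order \<open>k\<close> and the same value of \<open>chi8\<close>, so the weights add up to \<open>2 * M k\<close>
  instead of cancelling.\<close>

lemma twisted_sums_even_vanish:
  fixes M :: "nat \<Rightarrow> real"
  assumes fin: "finite B" and B: "\<And>l. l \<in> B \<Longrightarrow> l > 0 \<and> 8 dvd l"
    and sums: "\<And>n. n \<ge> 1 \<Longrightarrow> even n \<Longrightarrow> (\<Sum>l\<in>B. of_real (M l) * twisted_c l n) = 0"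
    and k: "k \<in> B" "16 dvd k"
  shows "M k = 0"
proof -
  define w :: "nat \<times> nat \<Rightarrow> complex" where "w = (\<lambda>(l, i). of_real (M l) * of_int (chi8 i))"
  define z :: "nat \<times> nat \<Rightarrow> complex" where "z = (\<lambda>(l, i). (zeta l ^ i)\<^sup>2)"
  have k0: "k > 0" using B k by blast
  have fibre: "{x. x \<in> Sigma B totatives \<and> z x = (zeta k)\<^sup>2} = {(k, 1), (k, 1 + k div 2)}"
    using zeta_square_eq_iff[OF k0 k(2)] k(1) by (auto simp: z_def)
  have "(\<Sum>x\<in>Sigma B totatives. w x * z x ^ n) = 0" if "n \<ge> 1" for n
  proof -
    have "(\<Sum>x\<in>Sigma B totatives. w x * z x ^ n) =
        (\<Sum>l\<in>B. \<Sum>i\<in>totatives l. of_real (M l) * of_int (chi8 i) * zeta l ^ (2 * n * i))"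
      by (subst sum.Sigma) (auto simp: fin w_def z_def mult_ac simp flip: power_mult intro!: sum.cong)
    also have "\<dots> = (\<Sum>l\<in>B. of_real (M l) * twisted_c l (2 * n))"
      by (simp add: twisted_c_def sum_distrib_left mult.assoc)
    also have "\<dots> = 0" using that by (intro sums) auto
    finally show ?thesis .
  qed
  then have "(\<Sum>x | x \<in> Sigma B totatives \<and> z x = (zeta k)\<^sup>2. w x) = 0"
    using fin by (intro power_sums_determine_weights) auto
  moreover have "chi8 (1 + k div 2) = 1"
  proof -
    obtain j where "k = 16 * j" using k(2) by (elim dvdE)
    then have "(1 + k div 2) mod 8 = 1" by simp
    then show ?thesis by (simp add: chi8_def)
  qed
  ultimately show ?thesis
    unfolding fibre using k0 by (simp add: w_def chi8_def) (use k in \<open>auto elim: dvdE\<close>)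
qed

text \<open>The difference between the shifted and the unshifted combination gives the root \<open>zeta k\<close> the weight \<open>w k * (zeta k ^ P - 1)\<close>, which must
  vanish.\<close>

lemma periodic_ramanujan_combination:
  fixes w :: "nat \<Rightarrow> complex"
  assumes fin: "finite C" and pos: "\<And>l. l \<in> C \<Longrightarrow> l > 0"
    and per: "\<And>n. n \<ge> 1 \<Longrightarrow>
      (\<Sum>l\<in>C. w l * ramanujan_c l (n + P)) = (\<Sum>l\<in>C. w l * ramanujan_c l n)"
    and k: "k \<in> C" "w k \<noteq> 0"
  shows "k dvd P"
proof -
  define v where "v = (\<lambda>(l, i). w l * (zeta l ^ (P * i) - 1))"
  define z where "z = (\<lambda>(l, i). zeta l ^ i)"
  have k0: "k > 0" using pos k by blast
  have fibre: "{x. x \<in> Sigma C totatives \<and> z x = zeta k} = {(k, 1)}"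
    using primitive_root_unique[of _ _ 1 k] k k0 by (auto simp: z_def)
  have "(\<Sum>x\<in>Sigma C totatives. v x * z x ^ n) = 0" if "n \<ge> 1" for n
  proof -
    have "(\<Sum>x\<in>Sigma C totatives. v x * z x ^ n) =
        (\<Sum>l\<in>C. \<Sum>i\<in>totatives l. w l * zeta l ^ ((n + P) * i) - w l * zeta l ^ (n * i))"
      by (subst sum.Sigma)
        (auto simp: fin v_def z_def algebra_simps power_add simp flip: power_mult intro!: sum.cong)
    also have "\<dots> = (\<Sum>l\<in>C. w l * ramanujan_c l (n + P)) - (\<Sum>l\<in>C. w l * ramanujan_c l n)"
      by (simp add: ramanujan_c_def sum_distrib_left sum_subtractf)
    also have "\<dots> = 0" using per[OF that] by simp
    finally show ?thesis .
  qed
  then have "(\<Sum>x | x \<in> Sigma C totatives \<and> z x = zeta k. v x) = 0"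
    using fin by (intro power_sums_determine_weights) auto
  then have "zeta k ^ P = zeta k ^ 0"
    unfolding fibre using k by (simp add: v_def)
  then show ?thesis
    using k0 by (simp only: zeta_power_eq_iff) auto
qed

lemma linear_system_entry:
  assumes "N' > 0" "n dvd N'"
  shows "mat_vec N' (mat_mul N' (mat_mul N' Delta_mat A_mat) Delta_mat) v n =
    (\<Sum>l | l dvd N'. of_int (chi8 n * chi8 l) * ramanujan_c l n * v l)"
proof -
  have fin: "finite {l. l dvd N'}" using assms(1) by (simp add: finite_divisors_nat)
  have 1: "mat_mul N' Delta_mat A_mat n k = of_int (chi8 n) * A_mat n k" for k
    using assms(2) fin
    by (simp add: mat_mul_def divisors_def Delta_mat_def if_distrib[of "\<lambda>x. x * _"] cong: if_cong)
  have 2: "mat_mul N' (mat_mul N' Delta_mat A_mat) Delta_mat n l =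
      of_int (chi8 n) * A_mat n l * of_int (chi8 l)" if "l dvd N'" for l
    unfolding mat_mul_def[of _ _ Delta_mat] 1 using that fin
    by (simp add: divisors_def Delta_mat_def if_distrib[of "\<lambda>x. _ * x"] cong: if_cong)
  show ?thesis
    unfolding mat_vec_def divisors_def
    by (intro sum.cong) (auto simp: 2 A_mat_def)
qed

theorem proposition5p5:
  fixes a :: "nat \<Rightarrow> 'k::alg_closed_field"
    and m d N e N' :: nat
    and mu mu_p mu_m :: "nat \<Rightarrow> nat"
  assumes char2: "CHAR('k) = 2"
    and m: "m \<ge> 1" "odd m"
    and d: "d \<ge> 1"
    and coeffs: "\<And>i. i \<le> d \<Longrightarrow> a i \<in> GF2 m"
    and lead: "a d \<noteq> 0"
    and splitting: "GF2 (m * N) = splitting_field (GF2 m) (R_tilde d a)"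
    and N: "N = 2 ^ e * N'" "odd N'"
    and exponents: "L_exponents m (f_poly d a) mu mu_p mu_m"
  shows "(\<forall>l\<ge>1. multiplicity 2 l \<noteq> 3 \<longrightarrow> neg_mult mu_p mu_m l = 0) \<and>
         (\<forall>l'. odd l' \<and> neg_mult mu_p mu_m (8 * l') \<noteq> 0 \<longrightarrow> l' dvd N') \<and>
         (\<forall>n\<in>divisors N'.
            - 2 * complex_of_real (sqrt 2) *
              mat_vec N' (mat_mul N' (mat_mul N' Delta_mat A_mat) Delta_mat)
                (\<lambda>l'. complex_of_real (neg_mult mu_p mu_m (8 * l'))) n
            = complex_of_real (exp_sum_star m (f_poly d a) n))"
proof -
  let ?M = "neg_mult mu_p mu_m"
  let ?S = "exp_sum_star m (f_poly d a)"
  define B where "B = {l. l > 0 \<and> multiplicity 2 l \<ge> 3 \<and> (mu_p l \<noteq> 0 \<or> mu_m l \<noteq> 0)}"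
  have fin: "finite B"
    using exponents unfolding L_exponents_def B_def Let_def by blast
  have B: "l > 0 \<and> 8 dvd l" if "l \<in> B" for l
    using that eight_dvd_iff[of l] by (simp add: B_def)
  have outside: "?M l = 0" if "l > 0" "l \<notin> B" for l
    using that by (auto simp: B_def neg_mult_def)
  have twisted: "(\<Sum>l\<in>B. of_real (?M l) * twisted_c l n) = (if even n then 0 else - of_real (?S n))"
    if "n \<ge> 1" for n
    unfolding B_def by (rule exp_sum_star_twisted[OF exponents m(2) that])
  have vanish: "?M k = 0" if "16 dvd k" "k > 0" for k
  proof (cases "k \<in> B")
    case True
    show ?thesis
      by (rule twisted_sums_even_vanish[OF fin B _ True that(1)]) (simp_all add: twisted)
  qed (use outside that in auto)
  \<comment> \<open>The odd parts of the levels \<open>8 * l'\<close>, the only ones left.\<close>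
  define C where "C = {l'. odd l' \<and> 8 * l' \<in> B}"
  define w :: "nat \<Rightarrow> complex" where "w l = of_int (chi8 l) * of_real (?M (8 * l))" for l
  have finC: "finite C"
  proof (rule finite_imageD)
    show "finite ((*) 8 ` C)" by (rule finite_subset[OF _ fin]) (auto simp: C_def)
  qed (simp add: inj_on_def)
  have expansion: "complex_of_real (?S n) =
      - of_real (2 * sqrt 2) * of_int (chi8 n) * (\<Sum>l\<in>C. w l * ramanujan_c l n)"
    if n: "odd n" for n
  proof -
    have "(\<Sum>l\<in>B. of_real (?M l) * twisted_c l n) = (\<Sum>l\<in>(*) 8 ` C. of_real (?M l) * twisted_c l n)"
    proof (rule sum.mono_neutral_right[OF fin])
      show "(*) 8 ` C \<subseteq> B" by (auto simp: C_def)
      show "\<forall>l\<in>B - (*) 8 ` C. of_real (?M l) * twisted_c l n = 0"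
      proof
        fix l assume l: "l \<in> B - (*) 8 ` C"
        then have "8 dvd l" using B by blast
        then obtain j where j: "l = 8 * j" by (elim dvdE)
        then have "even j" using l by (auto simp: C_def)
        then have "16 dvd l" using j by auto
        then show "of_real (?M l) * twisted_c l n = 0" using vanish[of l] B l by auto
      qed
    qed
    also have "\<dots> = (\<Sum>l\<in>C. of_real (?M (8 * l)) * twisted_c (8 * l) n)"
      by (subst sum.reindex) (auto simp: inj_on_def)
    also have "\<dots> = of_real (2 * sqrt 2) * of_int (chi8 n) * (\<Sum>l\<in>C. w l * ramanujan_c l n)"
      unfolding sum_distrib_left
    proof (intro sum.cong refl)
      fix l assume "l \<in> C"
      then have "odd l" by (simp add: C_def)
      show "of_real (?M (8 * l)) * twisted_c (8 * l) n =
          of_real (2 * sqrt 2) * of_int (chi8 n) * (w l * ramanujan_c l n)"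
        unfolding twisted_c_8_mult[OF \<open>odd l\<close> n] by (simp add: w_def)
    qed
    finally show ?thesis
      using twisted[of n] n by (cases n) auto
  qed
  have roots: "x \<in> GF2 (m * N)" if "poly (R_tilde d a) x = 0" for x
    unfolding splitting splitting_field_def using that by auto
  have "N' > 0" using N(2) by (cases N') auto
  define h where "h n = (\<Sum>l\<in>C. w l * ramanujan_c l n)" for n
  have h_gcd: "h n = h k" if "odd n" "odd k" "gcd n N' = gcd k N'" for n k
  proof -
    have chi_h: "of_int (chi8 n) * complex_of_real (?S n) = - of_real (2 * sqrt 2) * h n" if "odd n" for n
    proof -
      have "chi8 n * chi8 n = 1" using chi8_values[OF that] by auto
      then have "of_int (chi8 n) * of_int (chi8 n) = (1 :: complex)" by (metis of_int_1 of_int_mult)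
      then show ?thesis unfolding expansion[OF that] h_def by (simp add: mult_ac)
    qed
    have "of_int (chi8 n) * ?S n = of_int (chi8 k) * ?S k"
      using twisted_exp_sum_star_gcd[OF char2 m(2) coeffs roots N(1) that(1)]
        twisted_exp_sum_star_gcd[OF char2 m(2) coeffs roots N(1) that(2)] that(3) by simp
    from arg_cong[OF this, of complex_of_real]
    have "of_int (chi8 n) * complex_of_real (?S n) = of_int (chi8 k) * complex_of_real (?S k)"
      by simp
    then show ?thesis using chi_h that by simp
  qed
  \<comment> \<open>An odd common period of the Ramanujan sums in \<open>h\<close>, divisible by \<open>N'\<close>: it carries what is known for odd arguments over to even ones.\<close>
  define L where "L = N' * \<Prod>C"
  have "odd L" using N(2) finC by (auto simp: L_def C_def even_prod_iff)
  have h_shift: "h (n + L) = h n" for n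
  proof -
    have "ramanujan_c l (n + L) = ramanujan_c l n" if "l \<in> C" for l
    proof (rule ramanujan_c_periodic)
      show "l > 0" using that B by (auto simp: C_def intro!: Nat.gr0I)
      show "l dvd L" using dvd_prodI[OF finC that, of "\<lambda>x. x"] by (simp add: L_def)
    qed
    then show ?thesis by (simp add: h_def)
  qed
  have h_periodic: "h (n + N') = h n" for n
  proof -
    have gcd_L: "gcd (k + L) N' = gcd k N'" for k
      using gcd_add_mult[of N' "\<Prod>C" k] by (simp add: L_def ac_simps)
    have odd_rep: "\<exists>k'. odd k' \<and> gcd k' N' = gcd k N' \<and> h k' = h k" for k
    proof (cases "odd k")
      case False
      then have "odd (k + L)" using \<open>odd L\<close> by simp
      then show ?thesis using gcd_L h_shift by blast
    qed blast
    obtain n1 where n1: "odd n1" "gcd n1 N' = gcd n N'" "h n1 = h n"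
      using odd_rep by blast
    obtain n2 where n2: "odd n2" "gcd n2 N' = gcd (n + N') N'" "h n2 = h (n + N')"
      using odd_rep by blast
    show ?thesis using h_gcd[of n1 n2] n1 n2 by simp
  qed
  have support: "l dvd N'" if "odd l" "?M (8 * l) \<noteq> 0" for l
  proof (rule periodic_ramanujan_combination[OF finC, where w = w and k = l])
    show "0 < j" if "j \<in> C" for j using that B by (auto simp: C_def intro!: Nat.gr0I)
    show "(\<Sum>j\<in>C. w j * ramanujan_c j (n + N')) = (\<Sum>j\<in>C. w j * ramanujan_c j n)" for n
      using h_periodic[of n] by (simp add: h_def)
    have "l > 0" using that by (cases l) auto
    then show "l \<in> C" using that outside[of "8 * l"] by (auto simp: C_def)
    show "w l \<noteq> 0" using that chi8_values[of l] by (auto simp: w_def)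
  qed
  have system: "- 2 * complex_of_real (sqrt 2) *
      mat_vec N' (mat_mul N' (mat_mul N' Delta_mat A_mat) Delta_mat)
        (\<lambda>l'. complex_of_real (?M (8 * l'))) n = complex_of_real (?S n)"
    if n: "n dvd N'" for n
  proof -
    have "odd n" using n N(2) by auto
    have finN: "finite {l. l dvd N'}" using \<open>N' > 0\<close> by (simp add: finite_divisors_nat)
    have "(\<Sum>l\<in>C. w l * ramanujan_c l n) = (\<Sum>l | l dvd N'. w l * ramanujan_c l n)"
    proof (rule sum.mono_neutral_cong[OF finN finC])
      show "w l * ramanujan_c l n = 0" if "l \<in> {l. l dvd N'} - C" for l
      proof -
        have "odd l" "l > 0" using that N(2) by (auto intro!: Nat.gr0I)
        then show ?thesis using that outside[of "8 * l"] by (auto simp: C_def w_def)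
      qed
      show "w l * ramanujan_c l n = 0" if "l \<in> C - {l. l dvd N'}" for l
        using that support[of l] by (auto simp: C_def w_def)
    qed simp
    then show ?thesis
      unfolding expansion[OF \<open>odd n\<close>] linear_system_entry[OF \<open>N' > 0\<close> n]
      by (simp add: w_def sum_distrib_left mult_ac)
  qed
  have first: "?M l = 0" if "l \<ge> 1" "multiplicity 2 l \<noteq> 3" for l
  proof (cases "multiplicity 2 l \<le> 2")
    case False
    then have "multiplicity 2 l \<ge> 4" using that(2) by linarith
    then have "16 dvd l"
      using power_dvd_iff_le_multiplicity[of l 2 4] that(1) by simp
    then show ?thesis using vanish that(1) by simp
  qed (simp add: neg_mult_def)
  show ?thesis using first support system by (simp add: divisors_def)
qed

end
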